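(* Let $\varphi^\star$ have Hermite coefficients $(a_k^\star)_{k\ge 0}$ with $\sum_k k^2|a_k^\star|^2<\infty$, and information exponent $s=\inf\{k\ge 1 : a_k^\star\neq 0\}<\infty$. For each dimension $d$, let $(m_t,(a_{k,t})_{k\ge0})_{t\ge 0}$ solve $$\frac{d}{dt}a_{k,t}=a_k^\star m_t^k-a_{k,t}\quad(k\ge 0),\qquad \frac{d}{dt}m_t=(1-m_t^2)\sum_{k\ge1}k\,a_{k,t}a_k^\star m_t^{k-1},$$ started from the random initialization described in the context. Then with overwhelming probability on the initialization, there are dimension-independent constants such that the convergence below holds; precisely: for every $\eta\in(0,1)$ there exist constants $\kappa\in(0,1)$, $c,C,C'>0$ and $d_0\in\mathbb N$, depending only on $\varphi^\star$ and $\eta$, such that for every $d\ge d_0$, with probability at least $1-\eta$ over the initialization, there is a sequence $b=(b_k)_{k\ge0}$ with $b_k\ge0$ and $\|b\|_{\ell_2(\mathbb N)}=1$ for which the following holds. **Case $s\ge2$.** Let $\tau_\kappa=\inf\{t\ge0 : |m_t|\ge\kappa\}$. Then $\tau_\kappa<\infty$, $\tau_\kappa\ge C' d^{\,s-1}$, and for all $t\ge\tau_\kappa$: - if $m_0>0$: $|1-m_t|\le Ce^{-c(t-\tau_\kappa)}$ and $|a_{k,t}-a_k^\star|\le C b_k e^{-c(t-\tau_\kappa)}$ for all $k\in\mathbb N$; - if $m_0<0$: $|1+m_t|\le Ce^{-c(t-\tau_\kappa)}$ and $|a_{k,t}-(-1)^ka_k^\star|\le C b_k e^{-c(t-\tau_\kappa)}$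 for all $k\in\mathbb N$. **Case $s=1$.** For all $t\ge0$: - if $a_1^\star a_{1,0}>0$: $|1-m_t|\le Ce^{-ct}$ and $|a_{k,t}-a_k^\star|\le C b_k e^{-ct}$ for all $k\in\mathbb N$; - if $a_1^\star a_{1,0}<0$: $|1+m_t|\le Ce^{-ct}$ and $|a_{k,t}-(-1)^ka_k^\star|\le C b_k e^{-ct}$ for all $k\in\mathbb N$.
   Context: $\gamma$ is the standard Gaussian measure on $\mathbb R$, $(h_k)_{k\ge0}$ are the Hermite polynomials normalized to be an orthonormal basis of $L^2_\gamma(\mathbb R)$, and $a_k^\star=\langle\varphi^\star,h_k\rangle_{L^2_\gamma}$. The function $\varphi^\star$ is fixed, independent of $d$. $\mathbb N$ includes $0$. The ODE system describes the joint gradient flow of $\mathcal L(f,w)=\frac12\mathbb E[(f(\langle w,X\rangle)-Y)^2]$, $Y=\varphi^\star(\langle w^\star,X\rangle)+\varepsilon$, $X\sim\mathcal N(0,I_d)$, with $m_t=\langle w_t,w^\star\rangle\in[-1,1]$ and $a_{k,t}=\langle f_t,h_k\rangle_{L^2_\gamma}$. Initialization: $m_0=\langle w_0,w^\star\rangle$ where $w^\star$ is a fixed unit vector of $\mathbb R^d$ and $w_0$ is uniform on the unit sphere of $\mathbb R^d$; for each $k\ge1$, $k^2a_{k,0}$ is uniform on $[-1,1]$; all these variables are independent; and $a_{0,0}\in[-1,1]$ is arbitrary. A solution means $C^1$ functions $m:[0,\infty)\to[-1,1]$ and $a_k:[0,\infty)\to\mathbb R$ satisfying all the equations. *)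

theory Defs
  imports "HOL-Probability.Probability" "HOL-Library.Extended_Nat"
begin

text \<open>The normalized probabilists' Hermite polynomials: \<open>hermite n\<close> is monic of degree \<open>n\<close>,
  and \<open>hermite n / sqrt (n!)\<close> has norm 1 in \<open>L\<^sup>2\<close> of the standard Gaussian measure.\<close>

fun hermite :: "nat \<Rightarrow> real \<Rightarrow> real" where
  "hermite 0 x = 1"
| "hermite (Suc 0) x = x"
| "hermite (Suc (Suc n)) x = x * hermite (Suc n) x - real (Suc n) * hermite n x"

definition hermite_normalized :: "nat \<Rightarrow> real \<Rightarrow> real" where
  "hermite_normalized k x = hermite k x / sqrt (fact k)"

definition hermite_coeff :: "(real \<Rightarrow> real) \<Rightarrow> nat \<Rightarrow> real" where
  "hermite_coeff \<phi> k = (LINT x|std_normal_distribution. \<phi> x * hermite_normalized k x)"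

text \<open>The value is \<open>\<infinity>\<close> if all coefficients of positive index vanish.\<close>

definition information_exponent :: "(real \<Rightarrow> real) \<Rightarrow> enat" where
  "information_exponent \<phi> = (INF k \<in> {k. 1 \<le> k \<and> hermite_coeff \<phi> k \<noteq> 0}. enat k)"

text \<open>Since the dimension \<open>d\<close> is quantified inside the theorem, vectors of \<open>\<real>\<^sup>d\<close> are represented
  by functions in \<open>{..<d} \<rightarrow>\<^sub>E UNIV\<close>.\<close>

definition dot :: "nat \<Rightarrow> (nat \<Rightarrow> real) \<Rightarrow> (nat \<Rightarrow> real) \<Rightarrow> real" where
  "dot d x y = (\<Sum>i<d. x i * y i)"

definition unit_sphere :: "nat \<Rightarrow> (nat \<Rightarrow> real) set" where
  "unit_sphere d = {x \<in> {..<d} \<rightarrow>\<^sub>E UNIV. L2_set x {..<d} = 1}"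

definition lborel_d :: "nat \<Rightarrow> (nat \<Rightarrow> real) measure" where
  "lborel_d d = (\<Pi>\<^sub>M i\<in>{..<d}. lborel)"

definition unit_ball_d :: "nat \<Rightarrow> (nat \<Rightarrow> real) set" where
  "unit_ball_d d = {x \<in> {..<d} \<rightarrow>\<^sub>E UNIV. L2_set x {..<d} \<le> 1}"

definition normalize_d :: "nat \<Rightarrow> (nat \<Rightarrow> real) \<Rightarrow> (nat \<Rightarrow> real)" where
  "normalize_d d x = (\<lambda>i\<in>{..<d}. x i / L2_set x {..<d})"

text \<open>The uniform probability measure on the unit sphere, as the cone measure: the sphere measure
  of \<open>A\<close> is the normalized volume of the cone \<open>{r x | r \<in> [0,1], x \<in> A}\<close>. The origin, which
  \<open>normalize_d\<close> fixes, is a null set for \<open>d \<ge> 1\<close>.\<close>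

definition uniform_sphere :: "nat \<Rightarrow> (nat \<Rightarrow> real) measure" where
  "uniform_sphere d = distr (uniform_measure (lborel_d d) (unit_ball_d d)) (lborel_d d) (normalize_d d)"

text \<open>The joint law of \<open>(w\<^sub>0, (k\<^sup>2 a\<^sub>k\<^sub>,\<^sub>0)\<^sub>k\<^sub>\<ge>\<^sub>1)\<close>.\<close>

definition init_law :: "nat \<Rightarrow> ((nat \<Rightarrow> real) \<times> (nat \<Rightarrow> real)) measure" where
  "init_law d = uniform_sphere d \<Otimes>\<^sub>M (\<Pi>\<^sub>M k\<in>{1::nat..}. uniform_measure lborel {-1..1::real})"

definition has_C1_derivative :: "(real \<Rightarrow> real) \<Rightarrow> (real \<Rightarrow> real) \<Rightarrow> bool" where
  "has_C1_derivative f f' \<longleftrightarrow>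
     (\<forall>t\<ge>0. (f has_real_derivative f' t) (at t within {0..})) \<and> continuous_on {0..} f'"

text \<open>The sum over \<open>k \<ge> 1\<close> is reindexed by \<open>k = Suc j\<close>. It converges absolutely along every
  solution of the equations for \<open>a\<close> in the theorem, so \<open>suminf\<close> is a genuine sum there.\<close>

definition flow_solution ::
  "(nat \<Rightarrow> real) \<Rightarrow> (real \<Rightarrow> real) \<Rightarrow> (nat \<Rightarrow> real \<Rightarrow> real) \<Rightarrow> bool" where
  "flow_solution astar m a \<longleftrightarrow>
     (\<forall>t\<ge>0. m t \<in> {-1..1}) \<and>
     (\<forall>k. has_C1_derivative (a k) (\<lambda>t. astar k * m t ^ k - a k t)) \<and>
     has_C1_derivative m
       (\<lambda>t. (1 - (m t)\<^sup>2) * (\<Sum>j. real (Suc j) * a (Suc j) t * astar (Suc j) * m t ^ j))"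

definition initial_condition ::
  "nat \<Rightarrow> (nat \<Rightarrow> real) \<Rightarrow> (nat \<Rightarrow> real) \<Rightarrow> (nat \<Rightarrow> real) \<Rightarrow> real
    \<Rightarrow> (real \<Rightarrow> real) \<Rightarrow> (nat \<Rightarrow> real \<Rightarrow> real) \<Rightarrow> bool" where
  "initial_condition d wstar w0 u a00 m a \<longleftrightarrow>
     m 0 = dot d w0 wstar \<and> a 0 0 = a00 \<and> (\<forall>k\<ge>1. (real k)\<^sup>2 * a k 0 = u k)"

definition hitting_time :: "real \<Rightarrow> (real \<Rightarrow> real) \<Rightarrow> ereal" where
  "hitting_time \<kappa> m = (INF t \<in> {t. 0 \<le> t \<and> \<kappa> \<le> \<bar>m t\<bar>}. ereal t)"

end

theory Submission
  imports Defs "HOL-Real_Asymp.Real_Asymp"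
begin

text \<open>Write \<open>a\<^sub>k(t) = e\<^sup>-\<^sup>t a\<^sub>k(0) + p\<^sub>k(t)\<close>, where \<open>p\<^sub>k\<close> is driven by \<open>A\<^sub>k m\<^sup>k\<close> from zero. In the equation
  for \<open>m\<close> the first summand contributes at most \<open>M e\<^sup>-\<^sup>t \<bar>m\<bar>\<^sup>s\<^sup>-\<^sup>1\<close> with \<open>M = \<Sum> \<bar>A\<^sub>k\<bar>/k\<close>, and the second one
  is nonnegative as long as \<open>m \<ge> 0\<close>. The reflection \<open>m \<mapsto> -m\<close>, \<open>a\<^sub>k \<mapsto> (-1)\<^sup>k a\<^sub>k\<close> reduces to
  convergence to \<open>1\<close>.

  For \<open>s \<ge> 2\<close> and \<open>m\<^sub>0 > 0\<close> the function \<open>m exp (-M e\<^sup>-\<^sup>t)\<close> is nondecreasing, so \<open>m\<close> stays positive and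
  loses at most the factor \<open>e\<^sup>-\<^sup>M\<close> after any time. This gives both a uniform positive growth rate after
  \<open>m\<close> has reached \<open>1/2\<close> and the upper bound \<open>m' \<le> M e\<^sup>-\<^sup>t m + K m\<^sup>2\<^sup>s\<^sup>-\<^sup>1\<close>, whence
  \<open>\<tau>\<close> is at least of order \<open>(m\<^sub>0\<^sup>2)\<^sup>1\<^sup>-\<^sup>s\<close>. For \<open>s = 1\<close> and \<open>A\<^sub>1 a\<^sub>1(0) > 0\<close>, \<open>m\<close> reaches a small level \<open>\<delta>\<close> before time 1 and
  cannot go below it again. In both cases \<open>m' \<ge> \<gamma> (1 - m\<^sup>2)\<close> eventually, so everything decays
  exponentially.

  The initial overlap satisfies \<open>E m\<^sub>0\<^sup>2 \<le> 1/d\<close> because sign changes and permutations of coordinates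
  preserve the uniform measure, and \<open>m\<^sub>0 \<noteq> 0\<close> almost surely since hyperplanes are null.\<close>

section \<open>Calculus on the half line\<close>

text \<open>A derivative within \<open>{0..}\<close> is one-sided only at 0. Inside the interval it
  is two-sided, and at the endpoints continuity suffices, so the sign is asked for on the open
  interval only.\<close>

lemma nondecreasing_within:
  fixes f f' :: "real \<Rightarrow> real"
  assumes "0 \<le> t0" "t0 \<le> t1"
    and der: "\<And>t. t \<in> {t0..t1} \<Longrightarrow> (f has_real_derivative f' t) (at t within {0..})"
    and nn: "\<And>t. t \<in> {t0<..<t1} \<Longrightarrow> 0 \<le> f' t"
  shows "f t0 \<le> f t1"
proof (rule DERIV_nonneg_imp_increasing_open[OF \<open>t0 \<le> t1\<close>])
  fix x assume x: "t0 < x" "x < t1"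
  have "(f has_real_derivative f' x) (at x within {0<..})"
    using der[of x] x by (auto intro: DERIV_subset)
  then show "\<exists>y. (f has_real_derivative y) (at x) \<and> 0 \<le> y"
    using x assms(1) nn[of x] by (auto simp: at_within_open[of x "{0<..}"])
next
  show "continuous_on {t0..t1} f"
    by (rule DERIV_continuous_on[where D = f'], rule DERIV_subset[OF der]) (use assms in auto)
qed

text \<open>With the integrating factor \<open>exp t\<close>, the function
  \<open>exp t * (q t - L)\<close> has the nonnegative derivative
  \<open>exp t * (g t - L)\<close>.\<close>

lemma relaxation_lower_bound:
  fixes q g :: "real \<Rightarrow> real"
  assumes "0 \<le> t0" "t0 \<le> t1"
    and der: "\<And>t. t \<in> {t0..t1} \<Longrightarrow> (q has_real_derivative g t - q t) (at t within {0..})"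
    and g: "\<And>t. t \<in> {t0<..<t1} \<Longrightarrow> L \<le> g t"
  shows "L + exp (- (t1 - t0)) * (q t0 - L) \<le> q t1"
proof -
  have "exp t0 * (q t0 - L) \<le> exp t1 * (q t1 - L)"
    by (rule nondecreasing_within[where f' = "\<lambda>t. exp t * (g t - L)"])
       (use assms in \<open>auto intro!: derivative_eq_intros simp: algebra_simps\<close>)
  then have "exp (- t1) * (exp t0 * (q t0 - L)) \<le> exp (- t1) * (exp t1 * (q t1 - L))"
    by (intro mult_left_mono) auto
  then show ?thesis
    by (simp add: mult.assoc[symmetric] exp_add[symmetric] del: mult_le_cancel_left_pos)
qed

lemma relaxation_upper_bound:
  fixes q g :: "real \<Rightarrow> real"
  assumes "0 \<le> t0" "t0 \<le> t1"
    and der: "\<And>t. t \<in> {t0..t1} \<Longrightarrow> (q has_real_derivative g t - q t) (at t within {0..})"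
    and g: "\<And>t. t \<in> {t0<..<t1} \<Longrightarrow> g t \<le> U"
  shows "q t1 \<le> U + exp (- (t1 - t0)) * (q t0 - U)"
proof -
  have "- U + exp (- (t1 - t0)) * (- q t0 - (- U)) \<le> - q t1"
  proof (rule relaxation_lower_bound[OF assms(1,2), where g = "\<lambda>t. - g t"])
    fix t assume "t \<in> {t0..t1}"
    from DERIV_minus[OF der[OF this]]
    show "((\<lambda>t. - q t) has_real_derivative - g t - - q t) (at t within {0..})"
      by (simp add: algebra_simps)
  qed (use g in auto)
  then show ?thesis by (simp add: algebra_simps)
qed

text \<open>The times in the compact interval with \<open>f \<le> c\<close> have a minimum, and the
  intermediate value theorem excludes \<open>f < c\<close> there. Upward crossings follow by
  negating the function.\<close>

lemma first_time_le:
  fixes f :: "real \<Rightarrow> real"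
  assumes cont: "continuous_on {t0..} f" and "c < f t0" and "t0 \<le> t" "f t \<le> c"
  obtains \<sigma> where "t0 < \<sigma>" "\<sigma> \<le> t" "f \<sigma> = c" "\<And>r. t0 \<le> r \<Longrightarrow> r < \<sigma> \<Longrightarrow> c < f r"
proof -
  let ?Z = "{t0..t} \<inter> f -` {..c}"
  have ct: "continuous_on {t0..t} f" by (rule continuous_on_subset[OF cont]) auto
  have "closed ?Z" using ct by (intro continuous_closed_preimage) auto
  then have "compact ?Z"
    by (metis Int_lower1 bounded_closed_interval bounded_subset compact_eq_bounded_closed)
  moreover have "?Z \<noteq> {}" using assms by auto
  ultimately obtain \<sigma> where \<sigma>: "\<sigma> \<in> ?Z" "\<And>r. r \<in> ?Z \<Longrightarrow> \<sigma> \<le> r"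
    using compact_attains_inf by metis
  have before: "c < f r" if "t0 \<le> r" "r < \<sigma>" for r
    using \<sigma>(2)[of r] \<sigma>(1) that by (force simp: not_le)
  have "f \<sigma> = c"
  proof (rule ccontr)
    assume "f \<sigma> \<noteq> c"
    with \<sigma> have "f \<sigma> < c" by auto
    moreover have "continuous_on {t0..\<sigma>} f" by (rule continuous_on_subset[OF cont]) auto
    ultimately obtain x where x: "t0 \<le> x" "x \<le> \<sigma>" "f x = c"
      using IVT2'[of f \<sigma> c t0] assms \<sigma>(1) by auto
    with before[of x] \<open>f \<sigma> \<noteq> c\<close> show False by (cases "x = \<sigma>") auto
  qed
  moreover have "t0 < \<sigma>" using \<sigma>(1) assms \<open>f \<sigma> = c\<close> by (cases "\<sigma> = t0") auto
  ultimately show ?thesis using that \<sigma>(1) before by auto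
qed

text \<open>Induction via \<open>x ^ Suc k - 1 = x * (x ^ k - 1) + (x - 1)\<close>. The factor
  \<open>k\<close> is the price for passing from decay of \<open>1 - m\<close> to decay of
  \<open>1 - m ^ k\<close>; it returns in \<open>profile\<close>.\<close>

lemma one_minus_power_le:
  fixes x :: real
  assumes "-1 \<le> x" "x \<le> 1"
  shows "\<bar>x ^ k - 1\<bar> \<le> real k * (1 - x)"
proof (induction k)
  case (Suc k)
  have "\<bar>x ^ Suc k - 1\<bar> = \<bar>x * (x ^ k - 1) + (x - 1)\<bar>" by (simp add: algebra_simps)
  also have "\<dots> \<le> \<bar>x\<bar> * \<bar>x ^ k - 1\<bar> + (1 - x)"
    using assms by (intro order_trans[OF abs_triangle_ineq]) (auto simp: abs_mult)
  also have "\<bar>x\<bar> * \<bar>x ^ k - 1\<bar> \<le> 1 * (real k * (1 - x))"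
    using assms Suc by (intro mult_mono) auto
  finally show ?case by (simp add: algebra_simps)
qed auto

section \<open>Constants of the target coefficients and the common error profile\<close>

definition init_const :: "(nat \<Rightarrow> real) \<Rightarrow> real" where
  "init_const A = (\<Sum>j. \<bar>A (Suc j)\<bar> / real (Suc j))"

text \<open>Counterpart of \<open>init_const\<close> for the driven part: \<open>A k\<close> times
  the driven part of \<open>a k\<close> is at most \<open>(A k)\<^sup>2\<close> in absolute value,
  and the velocity weighs it with \<open>k\<close>.\<close>

definition drive_const :: "(nat \<Rightarrow> real) \<Rightarrow> real" where
  "drive_const A = (\<Sum>j. real (Suc j) * (A (Suc j))\<^sup>2)"

text \<open>The sequence \<open>b\<close> before normalization. The first summand dominates
  \<open>\<bar>a k 0\<bar>\<close>, the second covers the distance of the forcing from its target,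
  and \<open>k * \<bar>A k\<bar>\<close> is the Lipschitz constant of \<open>A k * x ^ k\<close> on
  \<open>[-1, 1]\<close>.\<close>

definition profile :: "(nat \<Rightarrow> real) \<Rightarrow> nat \<Rightarrow> real" where
  "profile A k = (if k = 0 then 1 else 1 / (real k)\<^sup>2) + 2 * \<bar>A k\<bar> + real k * \<bar>A k\<bar>"

locale sobolev_coeffs =
  fixes A :: "nat \<Rightarrow> real"
  assumes sobolev: "summable (\<lambda>k. (real k)\<^sup>2 * (A k)\<^sup>2)"
begin

lemma sobolev_Suc: "summable (\<lambda>j. (real (Suc j))\<^sup>2 * (A (Suc j))\<^sup>2)"
  using summable_Suc_iff[of "\<lambda>k. (real k)\<^sup>2 * (A k)\<^sup>2"] sobolev by blast

lemma summable_square: "summable (\<lambda>k. (A k)\<^sup>2)"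
proof -
  have "summable (\<lambda>j. (A (Suc j))\<^sup>2)"
  proof (rule summable_comparison_test'[OF sobolev_Suc])
    fix n have "1 * (A (Suc n))\<^sup>2 \<le> (real (Suc n))\<^sup>2 * (A (Suc n))\<^sup>2"
      by (intro mult_right_mono) (auto simp: one_le_power)
    then show "norm ((A (Suc n))\<^sup>2) \<le> (real (Suc n))\<^sup>2 * (A (Suc n))\<^sup>2" by simp
  qed
  then show ?thesis using summable_Suc_iff[of "\<lambda>k. (A k)\<^sup>2"] by blast
qed

lemma summable_drive: "summable (\<lambda>j. real (Suc j) * (A (Suc j))\<^sup>2)"
proof (rule summable_comparison_test'[OF sobolev_Suc])
  fix n have "real (Suc n) * (A (Suc n))\<^sup>2 \<le> (real (Suc n))\<^sup>2 * (A (Suc n))\<^sup>2"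
    by (intro mult_right_mono) (auto simp: power2_eq_square)
  then show "norm (real (Suc n) * (A (Suc n))\<^sup>2) \<le> (real (Suc n))\<^sup>2 * (A (Suc n))\<^sup>2" by simp
qed

text \<open>The arithmetic-geometric mean inequality compares the terms with
  \<open>(A k)\<^sup>2 + 1 / k\<^sup>2\<close>.\<close>

lemma summable_init: "summable (\<lambda>j. \<bar>A (Suc j)\<bar> / real (Suc j))"
proof (rule summable_comparison_test')
  show "summable (\<lambda>j. (A (Suc j))\<^sup>2 + 1 / (real (Suc j))\<^sup>2)"
    using summable_Suc_iff[of "\<lambda>k. (A k)\<^sup>2"] summable_square
      inverse_squares_sums sums_summable by (intro summable_add) (auto simp: sums_iff add.commute)
  fix n
  have "0 \<le> (\<bar>A (Suc n)\<bar> - 1 / real (Suc n))\<^sup>2" by simp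
  then have "2 * (\<bar>A (Suc n)\<bar> / real (Suc n)) \<le> (A (Suc n))\<^sup>2 + 1 / (real (Suc n))\<^sup>2"
    by (simp add: power2_diff power_divide)
  moreover have "0 \<le> \<bar>A (Suc n)\<bar> / real (Suc n)" by simp
  ultimately show "norm (\<bar>A (Suc n)\<bar> / real (Suc n)) \<le> (A (Suc n))\<^sup>2 + 1 / (real (Suc n))\<^sup>2"
    unfolding real_norm_def by linarith
qed

lemma init_const_nonneg: "0 \<le> init_const A"
  unfolding init_const_def by (intro suminf_nonneg summable_init) auto

lemma drive_const_nonneg: "0 \<le> drive_const A"
  unfolding drive_const_def by (intro suminf_nonneg summable_drive) auto

lemma drive_const_ge: "real (Suc j) * (A (Suc j))\<^sup>2 \<le> drive_const A"
  unfolding drive_const_def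
  using sum_le_suminf[OF summable_drive, of "{j}"] by auto

lemma profile_pos: "0 \<le> profile A k"
  by (auto simp: profile_def)

lemma summable_profile: "summable (\<lambda>k. (profile A k)\<^sup>2)"
proof -
  have "summable (\<lambda>j. (profile A (Suc j))\<^sup>2)"
  proof (rule summable_comparison_test')
    show "summable (\<lambda>j. 3 * (1 / (real (Suc j))\<^sup>2) + 12 * (A (Suc j))\<^sup>2
        + 3 * ((real (Suc j))\<^sup>2 * (A (Suc j))\<^sup>2))"
      using summable_Suc_iff[of "\<lambda>k. (A k)\<^sup>2"] summable_square sobolev_Suc
        inverse_squares_sums sums_summable
      by (intro summable_add summable_mult) (auto simp: sums_iff add.commute)
    fix n
    \<comment> \<open>Cauchy-Schwarz for three summands. The last of the resulting series is the
      Sobolev assumption itself.\<close>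
    have sq3: "(x + y + z)\<^sup>2 \<le> 3 * x\<^sup>2 + 3 * y\<^sup>2 + 3 * z\<^sup>2" for x y z :: real
      using zero_le_power2[of "x - y"] zero_le_power2[of "x - z"] zero_le_power2[of "y - z"]
      by (simp add: power2_eq_square algebra_simps)
    have "(1 / (real (Suc n))\<^sup>2)\<^sup>2 \<le> 1 / (real (Suc n))\<^sup>2"
      by (simp add: power_one_over[symmetric] power_mult[symmetric] del: of_nat_Suc)
         (intro power_decreasing, auto)
    then show "norm ((profile A (Suc n))\<^sup>2) \<le> 3 * (1 / (real (Suc n))\<^sup>2) + 12 * (A (Suc n))\<^sup>2
        + 3 * ((real (Suc n))\<^sup>2 * (A (Suc n))\<^sup>2)"
      using sq3[of "1 / (real (Suc n))\<^sup>2" "2 * \<bar>A (Suc n)\<bar>" "real (Suc n) * \<bar>A (Suc n)\<bar>"]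
      by (simp add: profile_def power_mult_distrib del: of_nat_Suc)
  qed
  then show ?thesis using summable_Suc_iff[of "\<lambda>k. (profile A k)\<^sup>2"] by blast
qed

definition profile_norm :: real where
  "profile_norm = sqrt (\<Sum>k. (profile A k)\<^sup>2)"

text \<open>The entry at index 0 is at least 1. Hence normalization never divides by zero, and
  multiplying a constant by the norm only weakens a bound.\<close>

lemma profile_norm_ge1: "1 \<le> profile_norm"
proof -
  have "1 \<le> (profile A 0)\<^sup>2" by (auto simp: profile_def)
  also have "\<dots> \<le> (\<Sum>k. (profile A k)\<^sup>2)"
    using sum_le_suminf[OF summable_profile, of "{0}"] by auto
  finally show ?thesis by (simp add: profile_norm_def)
qed

lemma normalized_profile_sums: "(\<lambda>k. (profile A k / profile_norm)\<^sup>2) sums 1"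
proof -
  have "profile_norm\<^sup>2 = (\<Sum>k. (profile A k)\<^sup>2)"
    unfolding profile_norm_def by (intro real_sqrt_pow2 suminf_nonneg summable_profile) auto
  moreover have "(\<lambda>k. (profile A k)\<^sup>2 / profile_norm\<^sup>2) sums ((\<Sum>k. (profile A k)\<^sup>2) / profile_norm\<^sup>2)"
    by (intro sums_divide summable_sums summable_profile)
  moreover have "profile_norm\<^sup>2 \<noteq> 0" using profile_norm_ge1 by simp
  ultimately show ?thesis by (simp add: power_divide)
qed

end

section \<open>The flow in general\<close>

definition flow_velocity :: "(nat \<Rightarrow> real) \<Rightarrow> (real \<Rightarrow> real) \<Rightarrow> (nat \<Rightarrow> real \<Rightarrow> real) \<Rightarrow> real \<Rightarrow> real" where
  "flow_velocity A m a t = (\<Sum>j. real (Suc j) * a (Suc j) t * A (Suc j) * m t ^ j)"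

text \<open>The bounds on the random initial coefficients hold almost surely; assuming them makes
  the analysis of the flow deterministic.\<close>

locale flow = sobolev_coeffs +
  fixes m :: "real \<Rightarrow> real" and a :: "nat \<Rightarrow> real \<Rightarrow> real"
  assumes solution: "flow_solution A m a"
    and init: "\<And>k. 1 \<le> k \<Longrightarrow> (real k)\<^sup>2 * \<bar>a k 0\<bar> \<le> 1"
    and init_0: "\<bar>a 0 0\<bar> \<le> 1"
begin

abbreviation S :: "real \<Rightarrow> real" where "S \<equiv> flow_velocity A m a"

lemma m_bounds: "0 \<le> t \<Longrightarrow> -1 \<le> m t" "0 \<le> t \<Longrightarrow> m t \<le> 1"
  and m_abs_le: "0 \<le> t \<Longrightarrow> \<bar>m t\<bar> \<le> 1"
  using solution by (auto simp: flow_solution_def abs_le_iff)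

lemma m_power_le_one: "0 \<le> t \<Longrightarrow> \<bar>m t ^ j\<bar> \<le> 1"
  using m_abs_le[of t] by (simp add: power_abs power_le_one)

lemma one_minus_m_square: "0 \<le> t \<Longrightarrow> 0 \<le> 1 - (m t)\<^sup>2" "1 - (m t)\<^sup>2 \<le> 1"
  using m_abs_le[of t] by (auto simp: abs_square_le_1)

lemma a_deriv:
  "0 \<le> t \<Longrightarrow> (a k has_real_derivative A k * m t ^ k - a k t) (at t within {0..})"
  using solution by (auto simp: flow_solution_def has_C1_derivative_def)

lemma m_deriv:
  "0 \<le> t \<Longrightarrow> (m has_real_derivative (1 - (m t)\<^sup>2) * S t) (at t within {0..})"
  using solution by (auto simp: flow_solution_def has_C1_derivative_def flow_velocity_def)

lemma a_continuous: "continuous_on {0..} (a k)"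
  by (rule DERIV_continuous_on[OF a_deriv]) auto

lemma m_continuous: "continuous_on {0..} m"
  by (rule DERIV_continuous_on[OF m_deriv]) auto

lemma init_Suc: "\<bar>a (Suc j) 0\<bar> \<le> 1 / (real (Suc j))\<^sup>2"
  using init[of "Suc j"] by (simp add: field_simps del: of_nat_Suc)

section \<open>Splitting off the initial transient\<close>

definition q :: "nat \<Rightarrow> real \<Rightarrow> real" where
  "q k t = A k * (a k t - exp (- t) * a k 0)"

lemma q_0 [simp]: "q k 0 = 0"
  by (simp add: q_def)

text \<open>Multiplying the driven part by \<open>A k\<close> turns the forcing into
  \<open>(A k)\<^sup>2 * m t ^ k\<close>, which is nonnegative whenever \<open>m t \<ge> 0\<close>,
  whatever the sign of \<open>A k\<close>.\<close>

lemma q_deriv: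
  "0 \<le> t \<Longrightarrow> (q k has_real_derivative (A k)\<^sup>2 * m t ^ k - q k t) (at t within {0..})"
  unfolding q_def
  by (auto intro!: derivative_eq_intros a_deriv simp: algebra_simps power2_eq_square)

lemma q_upper:
  assumes "0 \<le> t" "\<And>r. 0 \<le> r \<Longrightarrow> r \<le> t \<Longrightarrow> m r ^ k \<le> U" "0 \<le> U"
  shows "q k t \<le> (A k)\<^sup>2 * U"
proof -
  have "q k t \<le> (A k)\<^sup>2 * U + exp (- (t - 0)) * (q k 0 - (A k)\<^sup>2 * U)"
    by (rule relaxation_upper_bound[OF order_refl assms(1) q_deriv])
       (use assms in \<open>auto intro!: mult_left_mono\<close>)
  also have "\<dots> \<le> (A k)\<^sup>2 * U" using assms by simp
  finally show ?thesis .
qed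

lemma q_lower:
  assumes "0 \<le> t" "\<And>r. 0 \<le> r \<Longrightarrow> r \<le> t \<Longrightarrow> - U \<le> m r ^ k" "0 \<le> U"
  shows "- ((A k)\<^sup>2 * U) \<le> q k t"
proof -
  have "- ((A k)\<^sup>2 * U) \<le> - ((A k)\<^sup>2 * U) + exp (- (t - 0)) * (q k 0 - - ((A k)\<^sup>2 * U))"
    using assms by simp
  also have "\<dots> \<le> q k t"
    by (rule relaxation_lower_bound[OF order_refl assms(1) q_deriv])
       (use assms mult_left_mono[of "- U" _ "(A k)\<^sup>2"] in auto)
  finally show ?thesis .
qed

lemma q_abs_le: "0 \<le> t \<Longrightarrow> \<bar>q k t\<bar> \<le> (A k)\<^sup>2"
  using q_upper[of t k 1] q_lower[of t 1 k] m_power_le_one[of _ k]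
  by (auto simp: abs_le_iff)

text \<open>\<open>P\<close> is the velocity with all coefficients frozen at their initial values,
  \<open>Q\<close> the velocity produced by the driven parts.\<close>

definition P :: "real \<Rightarrow> real" where
  "P t = (\<Sum>j. real (Suc j) * A (Suc j) * a (Suc j) 0 * m t ^ j)"

definition Q :: "real \<Rightarrow> real" where
  "Q t = (\<Sum>j. real (Suc j) * q (Suc j) t * m t ^ j)"

lemma P_term_le:
  "\<bar>real (Suc j) * A (Suc j) * a (Suc j) 0\<bar> \<le> \<bar>A (Suc j)\<bar> / real (Suc j)"
proof -
  have "\<bar>real (Suc j) * A (Suc j) * a (Suc j) 0\<bar> = real (Suc j) * \<bar>A (Suc j)\<bar> * \<bar>a (Suc j) 0\<bar>"
    by (simp add: abs_mult)
  also have "\<dots> \<le> real (Suc j) * \<bar>A (Suc j)\<bar> * (1 / (real (Suc j))\<^sup>2)"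
    by (intro mult_left_mono init_Suc) auto
  also have "\<dots> = \<bar>A (Suc j)\<bar> / real (Suc j)" by (simp add: power2_eq_square)
  finally show ?thesis .
qed

lemma P_summable:
  assumes "0 \<le> t"
  shows "summable (\<lambda>j. real (Suc j) * A (Suc j) * a (Suc j) 0 * m t ^ j)"
proof (rule summable_comparison_test'[OF summable_init])
  fix n
  show "norm (real (Suc n) * A (Suc n) * a (Suc n) 0 * m t ^ n) \<le> \<bar>A (Suc n)\<bar> / real (Suc n)"
    using mult_mono[OF P_term_le[of n] m_power_le_one[OF assms, of n]]
    by (simp add: abs_mult)
qed

text \<open>Only indices \<open>k \<ge> s\<close> (and \<open>k \<ge> 1\<close>) survive, and for
  these \<open>\<bar>m t\<bar> ^ (k - 1) \<le> \<bar>m t\<bar> ^ (s - 1)\<close> because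
  \<open>\<bar>m t\<bar> \<le> 1\<close>.\<close>

lemma P_abs_le:
  assumes t: "0 \<le> t" and A_low: "\<And>k. 1 \<le> k \<Longrightarrow> k < s \<Longrightarrow> A k = 0"
  shows "\<bar>P t\<bar> \<le> init_const A * \<bar>m t\<bar> ^ (s - 1)"
proof -
  have *: "norm (real (Suc j) * A (Suc j) * a (Suc j) 0 * m t ^ j)
      \<le> \<bar>A (Suc j)\<bar> / real (Suc j) * \<bar>m t\<bar> ^ (s - 1)" for j
  proof (cases "Suc j < s")
    case True then show ?thesis using A_low[of "Suc j"] by simp
  next
    case False
    then have "\<bar>m t\<bar> ^ j \<le> \<bar>m t\<bar> ^ (s - 1)"
      using m_abs_le[OF t] by (intro power_decreasing) auto
    then show ?thesis
      using mult_mono[OF P_term_le[of j], of "\<bar>m t\<bar> ^ j" "\<bar>m t\<bar> ^ (s - 1)"]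
      by (simp add: abs_mult power_abs)
  qed
  have "norm (P t) \<le> (\<Sum>j. \<bar>A (Suc j)\<bar> / real (Suc j) * \<bar>m t\<bar> ^ (s - 1))"
    unfolding P_def by (intro norm_suminf_le summable_mult2 summable_init * )
  also have "\<dots> = init_const A * \<bar>m t\<bar> ^ (s - 1)"
    unfolding init_const_def by (intro suminf_mult2[symmetric] summable_init)
  finally show ?thesis by simp
qed

lemma Q_summable:
  assumes "0 \<le> t"
  shows "summable (\<lambda>j. real (Suc j) * q (Suc j) t * m t ^ j)"
proof (rule summable_comparison_test'[OF summable_drive])
  fix n
  have "real (Suc n) * (\<bar>q (Suc n) t\<bar> * \<bar>m t ^ n\<bar>) \<le> real (Suc n) * ((A (Suc n))\<^sup>2 * 1)"
    using assms by (intro mult_left_mono mult_mono q_abs_le m_power_le_one) auto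
  then show "norm (real (Suc n) * q (Suc n) t * m t ^ n) \<le> real (Suc n) * (A (Suc n))\<^sup>2"
    by (simp add: abs_mult mult.assoc)
qed

lemma S_decompose:
  assumes "0 \<le> t"
  shows "S t = exp (- t) * P t + Q t"
proof -
  have "exp (- t) * P t + Q t =
    (\<Sum>j. exp (- t) * (real (Suc j) * A (Suc j) * a (Suc j) 0 * m t ^ j)
         + real (Suc j) * q (Suc j) t * m t ^ j)"
    unfolding P_def Q_def
    by (subst suminf_mult[symmetric])
       (use assms in \<open>auto intro!: suminf_add P_summable Q_summable summable_mult simp del: of_nat_Suc\<close>)
  also have "\<dots> = S t"
    unfolding flow_velocity_def
    by (rule arg_cong[where f = suminf]) (auto simp: q_def algebra_simps)
  finally show ?thesis ..
qed

text \<open>The factor \<open>exp D\<close> absorbs the delay \<open>D\<close>, during which only \<open>1 - m \<le> 2\<close> is available.\<close>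

lemma one_minus_m_decay:
  assumes "0 \<le> t0" "0 \<le> D" "0 < \<gamma>"
    and S: "\<And>t. t0 + D \<le> t \<Longrightarrow> \<gamma> \<le> S t"
    and m: "\<And>t. t0 + D \<le> t \<Longrightarrow> 0 \<le> m t"
    and c: "0 \<le> c" "c \<le> \<gamma>" "c \<le> 1" and "t0 \<le> t"
  shows "1 - m t \<le> 2 * exp D * exp (- c * (t - t0))"
proof (cases "t \<le> t0 + D")
  case True
  have "c * (t - t0) \<le> 1 * D" using True assms by (intro mult_mono) auto
  then have "0 \<le> D - c * (t - t0)" by simp
  then have "1 \<le> exp (D - c * (t - t0))" by simp
  moreover have "1 - m t \<le> 2" using m_bounds(1)[of t] assms by simp
  moreover have "exp D * exp (- c * (t - t0)) = exp (D - c * (t - t0))"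
    by (simp add: exp_add[symmetric])
  ultimately show ?thesis by (simp only: mult.assoc)
next
  case False
  let ?T = "t0 + D"
  \<comment> \<open>From \<open>m \<ge> 0\<close> follows \<open>1 - m\<^sup>2 \<ge> 1 - m\<close>,
    so after the delay the gap \<open>1 - m\<close> decays at rate at least
    \<open>\<gamma> \<ge> c\<close>.\<close>
  have "exp (c * ?T) * (m ?T - 1) \<le> exp (c * t) * (m t - 1)"
  proof (rule nondecreasing_within[where f = "\<lambda>t. exp (c * t) * (m t - 1)" and f' =
        "\<lambda>t. exp (c * t) * ((1 - (m t)\<^sup>2) * S t + c * (m t - 1))"])
    fix r assume r: "r \<in> {?T<..<t}"
    have "c * (1 - m r) \<le> S r * (1 - m r)"
      using order_trans[OF c(2) S[of r]] r m_bounds[of r] assms(1,2)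
      by (intro mult_right_mono) auto
    also have "\<dots> \<le> S r * ((1 - m r) * (1 + m r))"
      using S[of r] \<open>0 < \<gamma>\<close> r m_bounds[of r] assms(1,2) m[of r]
      by (intro mult_left_mono) (auto simp: algebra_simps mult_left_le)
    finally have "0 \<le> (1 - (m r)\<^sup>2) * S r + c * (m r - 1)"
      by (simp add: power2_eq_square algebra_simps)
    then show "0 \<le> exp (c * r) * ((1 - (m r)\<^sup>2) * S r + c * (m r - 1))"
      by (intro mult_nonneg_nonneg) auto
  next
    fix r assume r: "r \<in> {?T..t}"
    then have "0 \<le> r" using assms(1,2) by simp
    then show "((\<lambda>t. exp (c * t) * (m t - 1)) has_real_derivative
        exp (c * r) * ((1 - (m r)\<^sup>2) * S r + c * (m r - 1))) (at r within {0..})"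
    proof -
      have "((\<lambda>t. exp (c * t)) has_real_derivative exp (c * r) * c) (at r within {0..})"
        by (auto intro!: derivative_eq_intros)
      from DERIV_mult[OF this DERIV_diff[OF m_deriv[OF \<open>0 \<le> r\<close>] DERIV_const[of 1]]]
      show ?thesis by (rule DERIV_cong) (simp add: algebra_simps)
    qed
  qed (use assms(1,2) False in auto)
  moreover have "exp (c * ?T) * (1 - m ?T) \<le> exp (c * ?T) * 2"
    using m_bounds(1)[of ?T] assms by (intro mult_left_mono) auto
  ultimately have "exp (- c * t) * (exp (c * t) * (1 - m t)) \<le> exp (- c * t) * (exp (c * ?T) * 2)"
    by (intro mult_left_mono) (auto simp: algebra_simps)
  moreover have "exp (- c * t) * exp (c * t) = 1"
    and "exp (- c * t) * exp (c * ?T) = exp (c * D) * exp (- c * (t - t0))"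
    by (simp_all add: exp_add[symmetric] algebra_simps)
  ultimately have "1 - m t \<le> 2 * exp (c * D) * exp (- c * (t - t0))"
    by (simp only: mult.assoc[symmetric] mult_1 mult.commute[of _ 2])
  also have "\<dots> \<le> 2 * exp D * exp (- c * (t - t0))"
    using assms mult_right_mono[of c 1 D] by (intro mult_right_mono) auto
  finally show ?thesis .
qed

text \<open>The coefficient relaxes toward forcing values between \<open>- \<bar>A k\<bar>\<close>
  and \<open>\<bar>A k\<bar>\<close>. Uniformity in \<open>t\<close> matters because the bound is
  later used at the hitting time, which grows with the dimension.\<close>

lemma a_initial_error: 
  assumes "0 \<le> t"
  shows "\<bar>a k t - A k\<bar> + real k * \<bar>A k\<bar> \<le> profile A k"
proof -
  have e: "exp (- t) \<le> 1" using assms by simp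
  have "(if k = 0 then 1 else 1 / (real k)\<^sup>2) \<ge> \<bar>a k 0\<bar>"
    using init_0 init_Suc[of "k - 1"] by auto
  moreover have "\<bar>a k t - A k\<bar> \<le> \<bar>a k 0\<bar> + 2 * \<bar>A k\<bar>"
  proof -
    have "a k t \<le> \<bar>A k\<bar> + exp (- (t - 0)) * (a k 0 - \<bar>A k\<bar>)"
    proof (rule relaxation_upper_bound[OF order_refl assms a_deriv])
      fix r assume "r \<in> {0<..<t}"
      then have "\<bar>A k * m r ^ k\<bar> \<le> \<bar>A k\<bar>"
        using m_power_le_one[of r k] by (auto simp: abs_mult intro!: mult_left_le)
      then show "A k * m r ^ k \<le> \<bar>A k\<bar>" by linarith
    qed auto
    moreover have "- \<bar>A k\<bar> + exp (- (t - 0)) * (a k 0 - - \<bar>A k\<bar>) \<le> a k t"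
    proof (rule relaxation_lower_bound[OF order_refl assms a_deriv])
      fix r assume "r \<in> {0<..<t}"
      then have "\<bar>A k * m r ^ k\<bar> \<le> \<bar>A k\<bar>"
        using m_power_le_one[of r k] by (auto simp: abs_mult intro!: mult_left_le)
      then show "- \<bar>A k\<bar> \<le> A k * m r ^ k" by linarith
    qed auto
    moreover have "\<bar>exp (- t) * a k 0\<bar> \<le> \<bar>a k 0\<bar>"
      using e by (auto simp: abs_mult intro!: mult_left_le_one_le)
    moreover have "0 \<le> exp (- t) * \<bar>A k\<bar>" "exp (- t) * \<bar>A k\<bar> \<le> \<bar>A k\<bar>"
      using e by (auto intro!: mult_left_le_one_le)
    ultimately show ?thesis
      unfolding right_diff_distrib mult_minus_right diff_0_right by linarith
  qed
  ultimately show ?thesis by (auto simp: profile_def)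
qed

text \<open>The error \<open>a k - A k\<close> relaxes at rate 1 under the forcing
  \<open>A k * (m ^ k - 1)\<close>, which decays at rate \<open>c\<close>. As
  \<open>c \<le> 1 / 2\<close>, the rate \<open>c\<close> survives, and the factor 2 bounds
  \<open>1 / (1 - c)\<close>.\<close>

lemma a_decay:
  assumes "0 \<le> t0" "0 \<le> c" "c \<le> 1 / 2" "1 \<le> K"
    and m: "\<And>t. t0 \<le> t \<Longrightarrow> 1 - m t \<le> K * exp (- c * (t - t0))" and "t0 \<le> t"
  shows "\<bar>a k t - A k\<bar> \<le> 2 * K * profile A k * exp (- c * (t - t0))"
proof -
  let ?B = "real k * \<bar>A k\<bar> * K"
  have B: "0 \<le> ?B" using assms by simp
  have drive: "\<bar>A k * (m r ^ k - 1)\<bar> \<le> ?B * exp (- c * (r - t0))" if "t0 \<le> r" for r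
  proof -
    have "\<bar>A k * (m r ^ k - 1)\<bar> \<le> \<bar>A k\<bar> * (real k * (1 - m r))"
      using m_bounds[of r] that assms(1) by (auto simp: abs_mult intro!: mult_left_mono one_minus_power_le)
    also have "\<dots> \<le> \<bar>A k\<bar> * (real k * (K * exp (- c * (r - t0))))"
      by (intro mult_left_mono m that) auto
    finally show ?thesis by (simp add: mult_ac)
  qed
  \<comment> \<open>The sign \<open>\<sigma>\<close> treats the upper and the lower bound on the
    error at once.\<close>
  have key: "\<sigma> * (a k t - A k) * exp (t - t0) \<le> \<sigma> * (a k t0 - A k) + 2 * ?B * exp ((1 - c) * (t - t0)) - 2 * ?B"
    if "\<sigma> = 1 \<or> \<sigma> = -1" for \<sigma> :: real
  proof -
    let ?f = "\<lambda>t. 2 * ?B * exp ((1 - c) * (t - t0)) - \<sigma> * (a k t - A k) * exp (t - t0)"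
    have "?f t0 \<le> ?f t"
    proof (rule nondecreasing_within[where f = ?f and f' =
          "\<lambda>r. 2 * ?B * ((1 - c) * exp ((1 - c) * (r - t0))) - \<sigma> * (A k * (m r ^ k - 1)) * exp (r - t0)"])
      fix r assume r: "r \<in> {t0<..<t}"
      have "\<sigma> * (A k * (m r ^ k - 1)) * exp (r - t0) \<le> ?B * exp (- c * (r - t0)) * exp (r - t0)"
        using drive[of r] r that by (intro mult_right_mono) auto
      also have "\<dots> = ?B * exp ((1 - c) * (r - t0))"
        by (simp add: mult.assoc exp_add[symmetric] algebra_simps)
      also have "\<dots> \<le> 2 * (1 - c) * (?B * exp ((1 - c) * (r - t0)))"
        using assms B mult_right_mono[of 1 "2 * (1 - c)" "?B * exp ((1 - c) * (r - t0))"] by simp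
      finally show "0 \<le> 2 * ?B * ((1 - c) * exp ((1 - c) * (r - t0)))
          - \<sigma> * (A k * (m r ^ k - 1)) * exp (r - t0)"
        by (simp add: algebra_simps)
    next
      fix r assume "r \<in> {t0..t}"
      then have "0 \<le> r" using assms(1) by simp
      then have *: "((\<lambda>t. \<sigma> * (a k t - A k)) has_real_derivative
          \<sigma> * (A k * m r ^ k - a k r)) (at r within {0..})"
        by (intro DERIV_cmult DERIV_cong[OF DERIV_diff[OF a_deriv DERIV_const]]) auto
      have "((\<lambda>t. 2 * ?B * exp ((1 - c) * (t - t0))) has_real_derivative
          2 * ?B * ((1 - c) * exp ((1 - c) * (r - t0)))) (at r within {0..})"
        "((\<lambda>t. exp (t - t0)) has_real_derivative exp (r - t0)) (at r within {0..})"
        by (auto intro!: derivative_eq_intros)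
      from DERIV_diff[OF this(1) DERIV_mult[OF *  this(2)]] show "(?f has_real_derivative 2 * ?B * ((1 - c) * exp ((1 - c) * (r - t0)))
          - \<sigma> * (A k * (m r ^ k - 1)) * exp (r - t0)) (at r within {0..})"
        by (rule DERIV_cong) (simp add: algebra_simps)
    qed (use assms(1) \<open>t0 \<le> t\<close> in auto)
    then show ?thesis by simp
  qed
  have ge1: "1 \<le> exp ((1 - c) * (t - t0))" using assms by simp
  have "\<bar>a k t - A k\<bar> * exp (t - t0) \<le> \<bar>a k t0 - A k\<bar> + 2 * ?B * exp ((1 - c) * (t - t0))"
    using key[of 1] key[of "-1"] B
    by (cases "0 \<le> a k t - A k") (auto simp: abs_if split: if_splits)
  \<comment> \<open>Both \<open>2 * K\<close> and the exponential are at least 1, so the error at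
    \<open>t0\<close> merges with the forcing term into a multiple of
    \<open>profile\<close>.\<close>
  also have "\<bar>a k t0 - A k\<bar> \<le> 2 * K * \<bar>a k t0 - A k\<bar> * exp ((1 - c) * (t - t0))"
  proof -
    have "1 * \<bar>a k t0 - A k\<bar> * 1 \<le> 2 * K * \<bar>a k t0 - A k\<bar> * exp ((1 - c) * (t - t0))"
      using assms ge1 by (intro mult_mono) auto
    then show ?thesis by simp
  qed
  finally have "\<bar>a k t - A k\<bar> * exp (t - t0)
      \<le> 2 * K * (\<bar>a k t0 - A k\<bar> + real k * \<bar>A k\<bar>) * exp ((1 - c) * (t - t0))"
    by (simp add: algebra_simps)
  also have "\<dots> \<le> 2 * K * profile A k * exp ((1 - c) * (t - t0))"
    using assms by (intro mult_right_mono mult_left_mono a_initial_error) auto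
  finally have "\<bar>a k t - A k\<bar> * exp (t - t0) * exp (- (t - t0)) \<le>
      2 * K * profile A k * exp ((1 - c) * (t - t0)) * exp (- (t - t0))"
    by (intro mult_right_mono) auto
  then show ?thesis
    by (simp add: mult.assoc exp_add[symmetric]) (simp add: algebra_simps)
qed

end

section \<open>Reflection symmetry of the flow\<close>

lemma flow_reflect:
  assumes "flow A m a"
  shows "flow A (\<lambda>t. - m t) (\<lambda>k t. (-1) ^ k * a k t)"
proof -
  interpret flow A m a by fact
  have 1: "A k * (- m t) ^ k - (-1) ^ k * a k t = (-1) ^ k * (A k * m t ^ k - a k t)" for k t
    by (simp add: power_minus[of "m t"] algebra_simps)
  have 2: "(1 - (- m t)\<^sup>2) * (\<Sum>j. real (Suc j) * ((-1) ^ Suc j * a (Suc j) t) * A (Suc j) * (- m t) ^ j)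
      = - ((1 - (m t)\<^sup>2) * (\<Sum>j. real (Suc j) * a (Suc j) t * A (Suc j) * m t ^ j))" if "0 \<le> t" for t
  proof -
    \<comment> \<open>The signs of \<open>(-1) ^ j\<close> and \<open>(- m t) ^ j\<close> cancel;
      one factor -1 remains because the coefficient has index \<open>Suc j\<close>.\<close>
    have *: "(-1) ^ j * ((-1) ^ j * x) = x" for j and x :: real
      by (simp add: mult.assoc[symmetric] power_mult_distrib[symmetric])
    have "real (Suc j) * ((-1) ^ Suc j * a (Suc j) t) * A (Suc j) * (- m t) ^ j
       = - (real (Suc j) * a (Suc j) t * A (Suc j) * m t ^ j)" for j
    proof -
      have "real (Suc j) * ((-1) ^ Suc j * a (Suc j) t) * A (Suc j) * (- m t) ^ j
         = - ((-1) ^ j * ((-1) ^ j * (real (Suc j) * a (Suc j) t * A (Suc j) * m t ^ j)))"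
        unfolding power_minus[of "m t"] by (simp del: of_nat_Suc)
      then show ?thesis unfolding * .
    qed
    then have "(\<lambda>j. real (Suc j) * ((-1) ^ Suc j * a (Suc j) t) * A (Suc j) * (- m t) ^ j)
       = (\<lambda>j. - (real (Suc j) * a (Suc j) t * A (Suc j) * m t ^ j))"
      by (rule ext)
    \<comment> \<open>Summability is what allows the minus sign to leave
      \<open>suminf\<close>.\<close>
    moreover have "summable (\<lambda>j. real (Suc j) * a (Suc j) t * A (Suc j) * m t ^ j)"
    proof -
      have "(\<lambda>j. real (Suc j) * a (Suc j) t * A (Suc j) * m t ^ j)
        = (\<lambda>j. exp (- t) * (real (Suc j) * A (Suc j) * a (Suc j) 0 * m t ^ j)
         + real (Suc j) * q (Suc j) t * m t ^ j)"
        by (auto simp: q_def algebra_simps)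
      then show ?thesis using P_summable[OF that] Q_summable[OF that] by (auto intro!: summable_add summable_mult)
    qed
    ultimately show ?thesis
      by (simp only: suminf_minus power2_minus mult_minus_right)
  qed
  have "flow_solution A (\<lambda>t. - m t) (\<lambda>k t. (-1) ^ k * a k t)"
    unfolding flow_solution_def has_C1_derivative_def 1
  proof (intro conjI allI impI)
    have "continuous_on {0..} (\<lambda>t. - ((1 - (m t)\<^sup>2) * (\<Sum>j. real (Suc j) * a (Suc j) t * A (Suc j) * m t ^ j)))"
      using solution by (intro continuous_on_minus) (auto simp: flow_solution_def has_C1_derivative_def)
    then show "continuous_on {0..} (\<lambda>t. (1 - (- m t)\<^sup>2) *
        (\<Sum>j. real (Suc j) * ((-1) ^ Suc j * a (Suc j) t) * A (Suc j) * (- m t) ^ j))"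
      by (subst continuous_on_cong[OF refl 2]) auto
  next
    fix t :: real assume t: "0 \<le> t"
    show "((\<lambda>t. - m t) has_real_derivative (1 - (- m t)\<^sup>2) *
        (\<Sum>j. real (Suc j) * ((-1) ^ Suc j * a (Suc j) t) * A (Suc j) * (- m t) ^ j)) (at t within {0..})"
      unfolding 2[OF t] using DERIV_minus[OF m_deriv[OF t]] by (simp add: flow_velocity_def)
  qed (use m_bounds a_deriv solution in
      \<open>auto intro!: continuous_intros m_continuous a_continuous DERIV_cmult simp: flow_solution_def has_C1_derivative_def\<close>)
  then show ?thesis
    by unfold_locales (use init init_0 in \<open>auto simp: abs_mult power_abs\<close>)
qed

section \<open>Escape for information exponent at least two\<close>

text \<open>The role of \<open>s \<ge> 2\<close> is that the initial term \<open>P\<close> vanishes with \<open>m\<close>, so it cannot push \<open>m\<close>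
  through zero.\<close>

locale escaping_flow = flow +
  fixes s :: nat
  assumes s_ge_2: "2 \<le> s"
    and A_low: "\<And>k. 1 \<le> k \<Longrightarrow> k < s \<Longrightarrow> A k = 0"
    and A_s: "A s \<noteq> 0"
    and m_0_pos: "0 < m 0"
begin

abbreviation M :: real where "M \<equiv> init_const A"
abbreviation N :: real where "N \<equiv> drive_const A"

lemma M_nonneg: "0 \<le> M" by (rule init_const_nonneg)

lemma N_pos: "0 < N"
proof -
  have "0 < real (Suc (s - 1)) * (A (Suc (s - 1)))\<^sup>2" using s_ge_2 A_s by simp
  then show ?thesis using drive_const_ge[of "s - 1"] by linarith
qed

section \<open>Positivity and almost monotonicity of the overlap\<close>

lemma P_small: "0 \<le> t \<Longrightarrow> \<bar>P t\<bar> \<le> M * \<bar>m t\<bar> ^ (s - 1)"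
  by (rule P_abs_le) (use A_low in auto)

lemma q_nonneg:
  assumes "0 \<le> t" "\<And>r. 0 \<le> r \<Longrightarrow> r \<le> t \<Longrightarrow> 0 \<le> m r"
  shows "0 \<le> q k t"
  using q_lower[of t 0 k] assms by auto

lemma Q_nonneg:
  assumes "0 \<le> t" "\<And>r. 0 \<le> r \<Longrightarrow> r \<le> t \<Longrightarrow> 0 \<le> m r"
  shows "0 \<le> Q t"
  unfolding Q_def using assms q_nonneg[OF assms]
  by (intro suminf_nonneg Q_summable) auto

text \<open>While \<open>m \<ge> 0\<close>, one has \<open>Q \<ge> 0\<close> and
  \<open>\<bar>P\<bar> \<le> M * m\<close>, so \<open>m' \<ge> - M * exp (- t) * m\<close>. The
  weight is the integrating factor of this inequality. The sign hypothesis is discharged later by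
  \<open>m_pos\<close>.\<close>

lemma m_weighted_mono_aux:
  assumes "0 \<le> t0" "t0 \<le> t1" and nn: "\<And>r. 0 \<le> r \<Longrightarrow> r \<le> t1 \<Longrightarrow> 0 \<le> m r"
  shows "m t0 * exp (- M * exp (- t0)) \<le> m t1 * exp (- M * exp (- t1))"
proof (rule nondecreasing_within[where f = "\<lambda>t. m t * exp (- M * exp (- t))" and f' =
      "\<lambda>t. exp (- M * exp (- t)) * ((1 - (m t)\<^sup>2) * S t + M * exp (- t) * m t)"])
  fix r assume r: "r \<in> {t0<..<t1}"
  then have r0: "0 \<le> r" "r \<le> t1" using assms by auto
  note m = nn[OF r0] m_bounds[OF r0(1)]
  have "m r ^ (s - 1) \<le> m r ^ 1" using m s_ge_2 by (intro power_decreasing) auto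
  then have "\<bar>P r\<bar> \<le> M * m r"
    using P_small[OF r0(1)] m mult_left_mono[OF _ M_nonneg, of "m r ^ (s - 1)" "m r"] by simp
  then have "exp (- r) * (- (M * m r)) \<le> exp (- r) * P r" by (intro mult_left_mono) auto
  moreover have "0 \<le> Q r" using r0 assms by (intro Q_nonneg) auto
  ultimately have S: "- (M * exp (- r) * m r) \<le> S r"
    unfolding S_decompose[OF r0(1)] by (simp add: mult_ac)
  have "(1 - (m r)\<^sup>2) * (M * exp (- r) * m r) \<le> 1 * (M * exp (- r) * m r)"
    using one_minus_m_square(2)[of r] m M_nonneg by (intro mult_right_mono) auto
  moreover have "(1 - (m r)\<^sup>2) * - (M * exp (- r) * m r) \<le> (1 - (m r)\<^sup>2) * S r"
    by (intro mult_left_mono S one_minus_m_square(1) r0)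
  ultimately have "0 \<le> (1 - (m r)\<^sup>2) * S r + M * exp (- r) * m r" by simp
  then show "0 \<le> exp (- M * exp (- r)) * ((1 - (m r)\<^sup>2) * S r + M * exp (- r) * m r)"
    by (intro mult_nonneg_nonneg) auto
next
  fix r assume "r \<in> {t0..t1}"
  then have "0 \<le> r" using assms by auto
  have "((\<lambda>t. exp (- M * exp (- t))) has_real_derivative exp (- M * exp (- r)) * (M * exp (- r)))
      (at r within {0..})"
    by (auto intro!: derivative_eq_intros)
  from DERIV_mult[OF m_deriv[OF \<open>0 \<le> r\<close>] this]
  show "((\<lambda>t. m t * exp (- M * exp (- t))) has_real_derivative
      exp (- M * exp (- r)) * ((1 - (m r)\<^sup>2) * S r + M * exp (- r) * m r)) (at r within {0..})"
    by (rule DERIV_cong) (simp add: algebra_simps)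
qed (use assms in auto)

text \<open>At a first zero the weighted overlap would have dropped from a positive value to 0,
  although \<open>m \<ge> 0\<close> up to that time makes it nondecreasing.\<close>

lemma m_pos:
  assumes "0 \<le> t"
  shows "0 < m t"
proof (rule ccontr)
  assume "\<not> 0 < m t"
  then obtain \<sigma> where \<sigma>: "0 < \<sigma>" "m \<sigma> = 0" "\<And>r. 0 \<le> r \<Longrightarrow> r < \<sigma> \<Longrightarrow> 0 < m r"
    using first_time_le[OF m_continuous m_0_pos assms] by (metis not_le)
  then have "0 \<le> m r" if "0 \<le> r" "r \<le> \<sigma>" for r
    using that by (cases "r = \<sigma>") (auto intro: less_imp_le)
  then have "m 0 * exp (- M * exp (- 0)) \<le> m \<sigma> * exp (- M * exp (- \<sigma>))"
    using \<sigma>(1) by (intro m_weighted_mono_aux) auto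
  moreover have "0 < m 0 * exp (- M * exp (- 0))" using m_0_pos by simp
  ultimately show False using \<sigma>(2) by simp
qed

text \<open>The transient has bounded total strength:
  \<open>exp (- t0) - exp (- t1) \<le> 1\<close>, so the loss does not depend on the length of the
  interval.\<close>

lemma m_almost_mono:
  assumes "0 \<le> t0" "t0 \<le> t1"
  shows "m t0 * exp (- M) \<le> m t1"
proof -
  have "m t0 * exp (- M * exp (- t0)) * exp (M * exp (- t1))
      \<le> m t1 * exp (- M * exp (- t1)) * exp (M * exp (- t1))"
    using assms by (intro mult_right_mono m_weighted_mono_aux less_imp_le[OF m_pos]) auto
  then have "m t0 * exp (M * (exp (- t1) - exp (- t0))) \<le> m t1"
    by (simp add: mult.assoc exp_add[symmetric] right_diff_distrib)
  moreover have "M * (-1) \<le> M * (exp (- t1) - exp (- t0))"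
  proof (intro mult_left_mono M_nonneg)
    have "exp (- t0) \<le> 1" "0 \<le> exp (- t1)" using assms by auto
    then show "-1 \<le> exp (- t1) - exp (- t0)" by linarith
  qed
  then have "m t0 * exp (- M) \<le> m t0 * exp (M * (exp (- t1) - exp (- t0)))"
    using m_pos[OF assms(1)] by simp
  ultimately show ?thesis by linarith
qed

section \<open>Lower bound on the escape time\<close>

definition K :: real where "K = N * exp (M * s)"

lemma K_pos: "0 < K" using N_pos by (simp add: K_def)

text \<open>The driven part \<open>q k\<close> is controlled by the past maximum of
  \<open>m ^ s\<close>. Almost monotonicity replaces it by the present value at the cost of
  \<open>exp (M * s)\<close>, and the remaining factor \<open>m ^ (s - 1)\<close> completes the
  exponent \<open>2 * s - 1\<close>.\<close>

lemma Q_le: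
  assumes "0 \<le> t"
  shows "Q t \<le> K * m t ^ (2 * s - 1)"
proof -
  let ?E = "exp (M * s)"
  have "Q t \<le> (\<Sum>j. real (Suc j) * (A (Suc j))\<^sup>2 * (?E * m t ^ (2 * s - 1)))"
    unfolding Q_def
  proof (intro suminf_le Q_summable assms summable_mult2 summable_drive)
    fix j
    show "real (Suc j) * q (Suc j) t * m t ^ j
        \<le> real (Suc j) * (A (Suc j))\<^sup>2 * (?E * m t ^ (2 * s - 1))"
    proof (cases "Suc j < s")
      case True then show ?thesis using A_low[of "Suc j"] by (simp add: q_def)
    next
      case False
      have mt: "0 < m t" "m t \<le> 1" using m_pos m_bounds assms by auto
      have "q (Suc j) t \<le> (A (Suc j))\<^sup>2 * (?E * m t ^ s)"
      proof (rule q_upper[OF assms])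
        fix r assume r: "0 \<le> r" "r \<le> t"
        have "m r ^ Suc j \<le> m r ^ s"
          using False m_pos[of r] m_bounds[of r] r by (intro power_decreasing) auto
        also have "m r \<le> exp M * m t"
          using m_almost_mono[OF r] by (simp add: exp_minus field_simps)
        then have "m r ^ s \<le> (exp M * m t) ^ s"
          using m_pos[of r] r by (intro power_mono) auto
        also have "\<dots> = ?E * m t ^ s"
          by (simp add: power_mult_distrib exp_of_nat_mult[symmetric] mult.commute)
        finally show "m r ^ Suc j \<le> ?E * m t ^ s" .
      qed (use mt in auto)
      moreover have "m t ^ j \<le> m t ^ (s - 1)" using False mt by (intro power_decreasing) auto
      ultimately have "q (Suc j) t * m t ^ j \<le> (A (Suc j))\<^sup>2 * (?E * m t ^ s) * m t ^ (s - 1)"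
        using mt by (intro mult_mono) auto
      also have "\<dots> = (A (Suc j))\<^sup>2 * (?E * m t ^ (2 * s - 1))"
        using s_ge_2 by (simp add: mult.assoc power_add[symmetric] mult_2)
      finally show ?thesis by (simp add: mult.assoc mult_left_mono del: of_nat_Suc)
    qed
  qed
  also have "\<dots> = N * (?E * m t ^ (2 * s - 1))"
    unfolding drive_const_def by (intro suminf_mult2[symmetric] summable_drive)
  finally show ?thesis by (simp add: K_def mult.assoc)
qed

lemma escape_time_bound:
  assumes "0 \<le> t"
  shows "inverse ((m 0 * exp M) ^ (2 * s - 2))
    \<le> inverse (m t ^ (2 * s - 2)) + real (2 * s - 2) * K * t"
proof -
  let ?p = "2 * s - 2"
  \<comment> \<open>This factor cancels the linear term of
    \<open>m' \<le> M * exp (- t) * m + K * m ^ (2 * s - 1)\<close> and leaves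
    \<open>n' \<le> K * n ^ (2 * s - 1)\<close>; it also yields
    \<open>n 0 = m 0 * exp M\<close>.\<close>
  define n where "n r = m r * exp (M * exp (- r))" for r
  have n_pos: "0 < n r" if "0 \<le> r" for r using m_pos[OF that] by (simp add: n_def)
  have n_ge: "m r \<le> n r" if "0 \<le> r" for r
    using m_pos[OF that] M_nonneg by (simp add: n_def)
  define n' where "n' r = exp (M * exp (- r)) * ((1 - (m r)\<^sup>2) * S r - M * exp (- r) * m r)" for r
  have n_deriv: "(n has_real_derivative n' r) (at r within {0..})" if "0 \<le> r" for r
  proof -
    have "((\<lambda>t. exp (M * exp (- t))) has_real_derivative exp (M * exp (- r)) * - (M * exp (- r)))
        (at r within {0..})"
      by (auto intro!: derivative_eq_intros)
    from DERIV_mult[OF m_deriv[OF that] this] show ?thesis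
      unfolding n_def n'_def by (rule DERIV_cong) (simp add: algebra_simps)
  qed
  have n'_le: "n' r \<le> K * n r ^ (?p + 1)" if r: "0 \<le> r" for r
  proof -
    have mr: "0 < m r" "m r \<le> 1" using m_pos m_bounds r by auto
    have "m r ^ (s - 1) \<le> m r ^ 1" using mr s_ge_2 by (intro power_decreasing) auto
    then have "P r \<le> M * m r"
      using P_small[OF r] mr mult_left_mono[OF _ M_nonneg, of "m r ^ (s - 1)" "m r"] by simp
    then have "exp (- r) * P r \<le> exp (- r) * (M * m r)" by (intro mult_left_mono) auto
    then have S: "S r \<le> M * exp (- r) * m r + K * m r ^ (2 * s - 1)"
      using Q_le[OF r] unfolding S_decompose[OF r] by (simp only: mult_ac)
    have "(1 - (m r)\<^sup>2) * S r \<le> (1 - (m r)\<^sup>2) * (M * exp (- r) * m r + K * m r ^ (2 * s - 1))"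
      by (intro mult_left_mono S one_minus_m_square(1) r)
    also have "\<dots> \<le> 1 * (M * exp (- r) * m r + K * m r ^ (2 * s - 1))"
      using mr M_nonneg K_pos by (intro mult_right_mono) auto
    finally have "n' r \<le> exp (M * exp (- r)) * (K * m r ^ (2 * s - 1))"
      unfolding n'_def by (intro mult_left_mono) auto
    also have "\<dots> = K * m r ^ ?p * n r"
    proof -
      have "2 * s - 1 = Suc ?p" using s_ge_2 by simp
      then show ?thesis by (simp add: n_def)
    qed
    also have "\<dots> \<le> K * n r ^ ?p * n r"
      using mr K_pos n_ge[OF r] n_pos[OF r] by (intro mult_right_mono mult_left_mono power_mono) auto
    finally show ?thesis by (simp add: mult_ac)
  qed
  \<comment> \<open>The power \<open>n ^ (- ?p)\<close> linearizes the inequality: its derivative is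
    at least \<open>- ?p * K\<close>.\<close>
  have "inverse (n 0 ^ ?p) + real ?p * K * 0 \<le> inverse (n t ^ ?p) + real ?p * K * t"
  proof (rule nondecreasing_within[where f = "\<lambda>r. inverse (n r ^ ?p) + real ?p * K * r"
        and f' = "\<lambda>r. real ?p * (K - n' r / n r ^ (?p + 1))", OF order_refl assms])
    fix r assume r: "r \<in> {0..t}"
    then have nz: "n r \<noteq> 0" "0 \<le> r" using n_pos[of r] by auto
    have "((\<lambda>r. n r ^ ?p) has_real_derivative real ?p * n r ^ (?p - 1) * n' r) (at r within {0..})"
      by (intro DERIV_cong[OF DERIV_power[OF n_deriv[OF nz(2)]]]) (simp add: mult_ac)
    from DERIV_inverse'[OF this] nz
    have "((\<lambda>r. inverse (n r ^ ?p)) has_real_derivative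
       - (inverse (n r ^ ?p) * (real ?p * n r ^ (?p - 1) * n' r) * inverse (n r ^ ?p)))
       (at r within {0..})" by simp
    from DERIV_add[OF this DERIV_cmult[OF DERIV_ident, of "real ?p * K"]]
    show "((\<lambda>r. inverse (n r ^ ?p) + real ?p * K * r) has_real_derivative
        real ?p * (K - n' r / n r ^ (?p + 1))) (at r within {0..})"
    proof (rule DERIV_cong)
      have p: "?p = Suc (?p - 1)" using s_ge_2 by linarith
      have n1: "n r ^ ?p = n r ^ (?p - 1) * n r" by (subst p) (rule power_Suc2)
      then have n2: "n r ^ (?p + 1) = n r ^ (?p - 1) * n r * n r"
        by (simp only: Suc_eq_plus1[symmetric] power_Suc2)
      have "- (inverse (x * y) * (z * x * w) * inverse (x * y)) + z * K * 1 = z * (K - w / (x * y * y))"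
        if "x \<noteq> 0" "y \<noteq> 0" for x y z w :: real
        using that by (simp add: field_simps)
      from this[of "n r ^ (?p - 1)" "n r" "real ?p" "n' r"]
      show "- (inverse (n r ^ ?p) * (real ?p * n r ^ (?p - 1) * n' r) * inverse (n r ^ ?p))
          + real ?p * K * 1 = real ?p * (K - n' r / n r ^ (?p + 1))"
        unfolding n1 n2 using nz by simp
    qed
  next
    fix r assume r: "r \<in> {0<..<t}"
    then show "0 \<le> real ?p * (K - n' r / n r ^ (?p + 1))"
      using n'_le[of r] n_pos[of r] by (simp add: divide_le_eq zero_le_mult_iff)
  qed
  moreover have "inverse (n t ^ ?p) \<le> inverse (m t ^ ?p)"
    using m_pos[OF assms] n_ge[OF assms] by (intro le_imp_inverse_le power_mono) auto
  ultimately show ?thesis by (simp add: n_def)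
qed

section \<open>Lower bound on the velocity and convergence after escape\<close>

definition speed :: "real \<Rightarrow> real" where
  "speed \<mu> = (A s)\<^sup>2 * \<mu> ^ (2 * s - 1) / 4"

lemma speed_pos: "0 < \<mu> \<Longrightarrow> 0 < speed \<mu>"
  using A_s by (simp add: speed_def)

text \<open>The limit contribution of index \<open>s\<close> is at least
  \<open>4 * speed \<mu>\<close>. One time unit of relaxation secures half of it, since
  \<open>exp (- 1) \<le> 1 / 2\<close>, and the transient \<open>P\<close> costs at most another
  \<open>speed \<mu>\<close>.\<close>

lemma S_ge_speed:
  assumes "0 \<le> t0" "0 < \<mu>" and m: "\<And>t. t0 \<le> t \<Longrightarrow> \<mu> \<le> m t"
    and small: "M * exp (- t0) \<le> speed \<mu>" and t: "t0 + 1 \<le> t"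
  shows "speed \<mu> \<le> S t"
proof -
  let ?L = "(A s)\<^sup>2 * \<mu> ^ s"
  have t0: "0 \<le> t" using assms by simp
  have mt: "0 < m t" "m t \<le> 1" using m_pos m_bounds t0 by auto
  have q0: "0 \<le> q k t" for k
    using t0 m_pos by (intro q_nonneg) (auto intro: less_imp_le)
  have qs: "?L / 2 \<le> q s t"
  proof -
    have "?L + exp (- (t - t0)) * (q s t0 - ?L) \<le> q s t"
    proof (rule relaxation_lower_bound[OF _ _ q_deriv])
      fix r assume "r \<in> {t0<..<t}"
      then show "?L \<le> (A s)\<^sup>2 * m r ^ s"
        using m[of r] assms by (intro mult_left_mono power_mono) auto
    qed (use assms in auto)
    moreover have "exp (- (t - t0)) * (- ?L) \<le> exp (- (t - t0)) * (q s t0 - ?L)"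
      using q_nonneg[of t0 s] m_pos assms by (intro mult_left_mono) (auto intro: less_imp_le)
    moreover have "exp (- (t - t0)) \<le> 1 / 2"
    proof -
      have "2 \<le> exp (t - t0)" using exp_ge_add_one_self[of "t - t0"] t by linarith
      then show ?thesis unfolding exp_minus[of "t - t0"] by (simp add: field_simps)
    qed
    then have "exp (- (t - t0)) * ?L \<le> 1 / 2 * ?L" using assms by (intro mult_right_mono) auto
    ultimately show ?thesis by simp
  qed
  have "real s * q s t * m t ^ (s - 1) \<le> Q t"
  proof -
    \<comment> \<open>Position \<open>s - 1\<close> of the reindexed series is the term with
      \<open>k = s\<close>; all other terms are nonnegative.\<close>
    have "sum (\<lambda>j. real (Suc j) * q (Suc j) t * m t ^ j) {s - 1} \<le> Q t"
      unfolding Q_def using t0 mt q0 by (intro sum_le_suminf Q_summable) auto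
    then show ?thesis using s_ge_2 by simp
  qed
  moreover have "2 * speed \<mu> \<le> real s * q s t * m t ^ (s - 1)"
  proof -
    have "1 * (?L / 2) * \<mu> ^ (s - 1) \<le> real s * q s t * m t ^ (s - 1)"
      using assms(2) s_ge_2 mt m[of t] t qs q0[of s]
      by (intro mult_mono power_mono mult_nonneg_nonneg) auto
    also have "1 * (?L / 2) * \<mu> ^ (s - 1) = 2 * ((A s)\<^sup>2 * (\<mu> ^ s * \<mu> ^ (s - 1)) / 4)"
      by simp
    also have "\<mu> ^ s * \<mu> ^ (s - 1) = \<mu> ^ (2 * s - 1)"
    proof -
      have "s + (s - 1) = 2 * s - 1" using s_ge_2 by linarith
      then show ?thesis by (simp only: power_add[symmetric])
    qed
    also have "2 * ((A s)\<^sup>2 * \<mu> ^ (2 * s - 1) / 4) = 2 * speed \<mu>"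
      by (simp add: speed_def)
    finally show ?thesis .
  qed
  moreover have "- speed \<mu> \<le> exp (- t) * P t"
  proof -
    have "\<bar>exp (- t) * P t\<bar> \<le> exp (- t0) * (M * 1)"
    proof -
      have "\<bar>m t\<bar> ^ (s - 1) \<le> 1" using mt by (simp add: power_le_one)
      then have "\<bar>P t\<bar> \<le> M * 1"
        using P_small[OF t0] mult_left_mono[OF _ M_nonneg, of "\<bar>m t\<bar> ^ (s - 1)" 1] by simp
      then show ?thesis using t M_nonneg unfolding abs_mult by (intro mult_mono) auto
    qed
    then show ?thesis using small by (simp add: mult.commute)
  qed
  ultimately show ?thesis unfolding S_decompose[OF t0] by linarith
qed

text \<open>Almost monotonicity keeps \<open>m\<close> above \<open>m 0 * exp (- M)\<close>, so the
  velocity is eventually positive and \<open>m\<close> tends to 1. The rate depends on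
  \<open>m 0\<close>, which is harmless since only finiteness of the hitting time is
  concluded.\<close>

lemma m_reaches_half: "\<exists>t\<ge>0. 1 / 2 \<le> m t"
proof -
  define \<mu> where "\<mu> = m 0 * exp (- M)"
  have \<mu>: "0 < \<mu>" "\<And>t. 0 \<le> t \<Longrightarrow> \<mu> \<le> m t"
    using m_0_pos m_almost_mono[of 0] by (auto simp: \<mu>_def)
  have "((\<lambda>t. M * exp (- t)) \<longlongrightarrow> M * 0) at_top"
    by (intro tendsto_mult tendsto_const filterlim_compose[OF exp_at_bot] filterlim_uminus_at_bot_at_top)
  then have "\<forall>\<^sub>F t in at_top. M * exp (- t) < speed \<mu>"
    using speed_pos[OF \<mu>(1)] by (intro order_tendstoD) auto
  then obtain T where T: "\<And>t. T \<le> t \<Longrightarrow> M * exp (- t) < speed \<mu>"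
    unfolding eventually_at_top_linorder by auto
  define t0 where "t0 = max 0 T"
  have t0: "0 \<le> t0" "M * exp (- t0) \<le> speed \<mu>" using T[of t0] by (auto simp: t0_def)
  define c where "c = min (speed \<mu>) 1"
  have c: "0 < c" "c \<le> speed \<mu>" "c \<le> 1" using speed_pos[OF \<mu>(1)] by (auto simp: c_def)
  have decay: "1 - m t \<le> 2 * exp 1 * exp (- c * (t - t0))" if "t0 \<le> t" for t
    by (rule one_minus_m_decay[OF t0(1) _ speed_pos[OF \<mu>(1)] S_ge_speed[OF t0(1) \<mu>(1) _ t0(2)]])
       (use t0(1) \<mu>(2) c that less_imp_le[OF m_pos] in auto)
  have "((\<lambda>t. 2 * exp 1 * exp (- c * (t - t0))) \<longlongrightarrow> 2 * exp 1 * 0) at_top"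
    using c(1) by real_asymp
  then have "\<forall>\<^sub>F t in at_top. 2 * exp 1 * exp (- c * (t - t0)) < 1 / 2"
    by (intro order_tendstoD) auto
  moreover have "\<forall>\<^sub>F t in at_top. t0 \<le> t" by (rule eventually_ge_at_top)
  ultimately have "\<forall>\<^sub>F t in at_top. t0 \<le> t \<and> 2 * exp 1 * exp (- c * (t - t0)) < 1 / 2"
    by eventually_elim auto
  then obtain t where "t0 \<le> t" "2 * exp 1 * exp (- c * (t - t0)) < 1 / 2"
    using eventually_happens'[OF trivial_limit_at_top_linorder] by blast
  then show ?thesis using decay[of t] t0(1) by (intro exI[of _ t]) auto
qed

text \<open>Restart at the hitting time: from there on \<open>m \<ge> exp (- M) / 2\<close>, a level
  independent of \<open>m 0\<close>. The bound \<open>T \<le> B \<le> \<tau>\<close> ensures that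
  the transient has already faded.\<close>

lemma escape_and_converge:
  assumes m0: "m 0 < 1 / 2" and T: "M * exp (- T) \<le> speed (exp (- M) / 2)" "T \<le> B" "0 < B"
    and B: "2 ^ (2 * s - 2) + real (2 * s - 2) * K * B \<le> inverse ((m 0 * exp M) ^ (2 * s - 2))"
    and c: "0 \<le> c" "c \<le> speed (exp (- M) / 2)" "c \<le> 1 / 2"
  shows "\<exists>\<tau>. hitting_time (1 / 2) m = ereal \<tau> \<and> B \<le> \<tau> \<and>
    (\<forall>t\<ge>\<tau>. 1 - m t \<le> 2 * exp 1 * exp (- c * (t - \<tau>)) \<and>
      (\<forall>k. \<bar>a k t - A k\<bar> \<le> 4 * exp 1 * profile A k * exp (- c * (t - \<tau>))))"
proof -
  obtain t where "0 \<le> t" "1 / 2 \<le> m t" using m_reaches_half by blast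
  \<comment> \<open>The first upward crossing of \<open>m\<close> is the first downward crossing of
    \<open>- m\<close>.\<close>
  then obtain \<tau> where \<tau>: "0 < \<tau>" "m \<tau> = 1 / 2" "\<And>r. 0 \<le> r \<Longrightarrow> r < \<tau> \<Longrightarrow> m r < 1 / 2"
    using first_time_le[of 0 "\<lambda>t. - m t" "- (1 / 2)" t] m0 m_continuous
    by (auto intro: continuous_on_minus)
  have hit: "hitting_time (1 / 2) m = ereal \<tau>"
    unfolding hitting_time_def
  proof (rule antisym)
    show "(INF t\<in>{t. 0 \<le> t \<and> 1 / 2 \<le> \<bar>m t\<bar>}. ereal t) \<le> ereal \<tau>"
      using \<tau> by (intro INF_lower) auto
    show "ereal \<tau> \<le> (INF t\<in>{t. 0 \<le> t \<and> 1 / 2 \<le> \<bar>m t\<bar>}. ereal t)"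
    proof (rule INF_greatest)
      fix r assume "r \<in> {t. 0 \<le> t \<and> 1 / 2 \<le> \<bar>m t\<bar>}"
      then have "0 \<le> r" "1 / 2 \<le> m r" using m_pos[of r] by auto
      then show "ereal \<tau> \<le> ereal r" using \<tau>(3)[of r] by (cases "r < \<tau>") auto
    qed
  qed
  have B\<tau>: "B \<le> \<tau>"
  proof -
    \<comment> \<open>At \<open>\<tau>\<close> the right side of \<open>escape_time_bound\<close> is
      explicit, and comparison with hypothesis \<open>B\<close> bounds \<open>\<tau>\<close> from
      below.\<close>
    have "inverse (m \<tau> ^ (2 * s - 2)) = 2 ^ (2 * s - 2)"
      unfolding \<tau>(2) by (simp add: power_one_over)
    then have "real (2 * s - 2) * K * B \<le> real (2 * s - 2) * K * \<tau>"
      using escape_time_bound[of \<tau>] \<tau>(1) B by linarith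
    moreover have "0 < real (2 * s - 2) * K" using s_ge_2 K_pos by simp
    ultimately show ?thesis by (rule mult_left_le_imp_le)
  qed
  have \<mu>: "0 < exp (- M) / 2" by simp
  have "exp (- M) / 2 \<le> m t" if "\<tau> \<le> t" for t
    using m_almost_mono[of \<tau> t] \<tau> that by simp
  moreover have "M * exp (- \<tau>) \<le> M * exp (- T)" using B\<tau> T M_nonneg by (intro mult_left_mono) auto
  ultimately have S: "speed (exp (- M) / 2) \<le> S t" if "\<tau> + 1 \<le> t" for t
    using S_ge_speed[of \<tau> "exp (- M) / 2" t] \<tau>(1) T(1) that by auto
  have m_decay: "1 - m t \<le> 2 * exp 1 * exp (- c * (t - \<tau>))" if "\<tau> \<le> t" for t
  proof (rule one_minus_m_decay[OF _ _ speed_pos[OF \<mu>] S])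
    fix t assume "\<tau> + 1 \<le> t"
    then show "0 \<le> m t" using \<tau>(1) m_pos[of t] by simp
  qed (use \<tau>(1) c that in simp_all)
  moreover have "\<bar>a k t - A k\<bar> \<le> 4 * exp 1 * profile A k * exp (- c * (t - \<tau>))" if "\<tau> \<le> t" for t k
  proof -
    have "(1::real) \<le> 2 * exp 1" using exp_ge_add_one_self[of "1::real"] by linarith
    from a_decay[OF _ c(1,3) this m_decay that] \<tau>(1) show ?thesis by simp
  qed
  ultimately show ?thesis using hit B\<tau> by blast
qed

end

section \<open>Information exponent one\<close>

text \<open>While \<open>\<bar>m\<bar> \<le> \<delta>\<close>, the bound on
  \<open>init_const\<close> leaves \<open>P \<ge> 3 / 4 * e0\<close> and the one on
  \<open>drive_const\<close> makes \<open>Q\<close> negligible. The last bound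
  \<open>16 * \<delta> \<le> e0\<close> lets growth at rate \<open>e0 / 8\<close> cover the distance
  \<open>2 * \<delta>\<close> in unit time.\<close>

locale linear_flow = flow +
  fixes e0 \<delta> :: real
  assumes e0: "0 < e0" "e0 \<le> A 1 * a 1 0"
    and \<delta>: "0 < \<delta>" "\<delta> \<le> 1 / 2" "init_const A * \<delta> \<le> e0 / 4" "drive_const A * \<delta> \<le> e0 / 40" "16 * \<delta> \<le> e0"
    and m_0_small: "\<bar>m 0\<bar> < \<delta>"
begin

abbreviation M :: real where "M \<equiv> init_const A"
abbreviation N :: real where "N \<equiv> drive_const A"

text \<open>The term \<open>k = 1\<close> does not involve \<open>m\<close>; all others carry at
  least one factor \<open>m\<close>.\<close>

lemma P_ge:
  assumes "0 \<le> t"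
  shows "A 1 * a 1 0 - M * \<bar>m t\<bar> \<le> P t"
proof (rule sums_le)
  show "(\<lambda>j. (if j = 0 then A 1 * a 1 0 else 0) - \<bar>A (Suc j)\<bar> / real (Suc j) * \<bar>m t\<bar>)
      sums (A 1 * a 1 0 - M * \<bar>m t\<bar>)"
    unfolding init_const_def
    using sums_single[of 0 "\<lambda>_. A 1 * a 1 0"]
    by (intro sums_diff sums_mult2 summable_sums summable_init) auto
  show "(\<lambda>j. real (Suc j) * A (Suc j) * a (Suc j) 0 * m t ^ j) sums P t"
    unfolding P_def by (intro summable_sums P_summable assms)
  show "(if j = 0 then A 1 * a 1 0 else 0) - \<bar>A (Suc j)\<bar> / real (Suc j) * \<bar>m t\<bar>
      \<le> real (Suc j) * A (Suc j) * a (Suc j) 0 * m t ^ j" for j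
  proof (cases "j = 0")
    case True then show ?thesis by simp
  next
    case False
    have "\<bar>m t\<bar> ^ j \<le> \<bar>m t\<bar> ^ 1"
      using False m_abs_le[OF assms] by (intro power_decreasing) auto
    then have "\<bar>real (Suc j) * A (Suc j) * a (Suc j) 0 * m t ^ j\<bar> \<le> \<bar>A (Suc j)\<bar> / real (Suc j) * \<bar>m t\<bar>"
      using mult_mono[OF P_term_le[of j], of "\<bar>m t\<bar> ^ j" "\<bar>m t\<bar>"]
      by (simp add: abs_mult power_abs)
    then show ?thesis using False by simp
  qed
qed

lemma Q_abs_le:
  assumes "0 \<le> t" and q: "\<And>k. 1 \<le> k \<Longrightarrow> \<bar>q k t\<bar> \<le> (A k)\<^sup>2 * U"
  shows "\<bar>Q t\<bar> \<le> N * U"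
proof -
  have *: "norm (real (Suc j) * q (Suc j) t * m t ^ j) \<le> real (Suc j) * (A (Suc j))\<^sup>2 * U" for j
  proof -
    have "real (Suc j) * (\<bar>q (Suc j) t\<bar> * \<bar>m t ^ j\<bar>) \<le> real (Suc j) * (((A (Suc j))\<^sup>2 * U) * 1)"
      using q[of "Suc j"] m_power_le_one[OF assms(1), of j]
      by (intro mult_left_mono mult_mono) auto
    then show ?thesis by (simp add: abs_mult mult.assoc)
  qed
  have "norm (Q t) \<le> (\<Sum>j. real (Suc j) * (A (Suc j))\<^sup>2 * U)"
    unfolding Q_def by (intro norm_suminf_le summable_mult2 summable_drive * )
  also have "\<dots> = N * U"
    unfolding drive_const_def by (intro suminf_mult2[symmetric] summable_drive)
  finally show ?thesis by simp
qed

text \<open>The term \<open>q 1\<close> is kept exactly because it will supply the positive limiting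
  velocity; the others only need their negative parts bounded.\<close>

lemma Q_ge:
  assumes t: "0 \<le> t" "0 \<le> m t" and U: "0 \<le> U"
    and q: "\<And>k. 1 \<le> k \<Longrightarrow> - ((A k)\<^sup>2 * U) \<le> q k t"
  shows "q 1 t - N * U \<le> Q t"
proof (rule sums_le)
  show "(\<lambda>j. (if j = 0 then q 1 t else 0) - real (Suc j) * (A (Suc j))\<^sup>2 * U) sums (q 1 t - N * U)"
    unfolding drive_const_def
    using sums_single[of 0 "\<lambda>_. q 1 t"]
    by (intro sums_diff sums_mult2 summable_sums summable_drive) auto
  show "(\<lambda>j. real (Suc j) * q (Suc j) t * m t ^ j) sums Q t"
    unfolding Q_def by (intro summable_sums Q_summable t)
  show "(if j = 0 then q 1 t else 0) - real (Suc j) * (A (Suc j))\<^sup>2 * U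
      \<le> real (Suc j) * q (Suc j) t * m t ^ j" for j
  proof (cases "j = 0")
    case True then show ?thesis using U by simp
  next
    case False
    have mt: "0 \<le> m t ^ j" "m t ^ j \<le> 1" using t m_bounds[OF t(1)] by (auto intro: power_le_one)
    have "(A (Suc j))\<^sup>2 * U * m t ^ j \<le> (A (Suc j))\<^sup>2 * U * 1"
      using mt U by (intro mult_left_mono) auto
    moreover have "- ((A (Suc j))\<^sup>2 * U) * m t ^ j \<le> q (Suc j) t * m t ^ j"
      using mt q[of "Suc j"] by (intro mult_right_mono) auto
    ultimately have "real (Suc j) * (- ((A (Suc j))\<^sup>2 * U)) \<le> real (Suc j) * (q (Suc j) t * m t ^ j)"
      by (intro mult_left_mono) auto
    then show ?thesis using False by (simp add: mult.assoc)
  qed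
qed

section \<open>Reaching the level \<delta>\<close>

lemma growth:
  assumes "0 \<le> t" "t \<le> 1" and m: "\<And>r. 0 \<le> r \<Longrightarrow> r \<le> t \<Longrightarrow> \<bar>m r\<bar> \<le> \<delta>"
  shows "m 0 + e0 / 8 * t \<le> m t"
proof -
  have "m 0 - e0 / 8 * 0 \<le> m t - e0 / 8 * t"
  proof (rule nondecreasing_within[where f = "\<lambda>r. m r - e0 / 8 * r" and
        f' = "\<lambda>r. (1 - (m r)\<^sup>2) * S r - e0 / 8", OF order_refl assms(1)])
    fix r assume r: "r \<in> {0..t}"
    have "((\<lambda>r. e0 / 8 * r) has_real_derivative e0 / 8 * 1) (at r within {0..})"
      by (intro DERIV_cmult DERIV_ident)
    with DERIV_diff[OF m_deriv[of r] this] r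
    show "((\<lambda>r. m r - e0 / 8 * r) has_real_derivative (1 - (m r)\<^sup>2) * S r - e0 / 8) (at r within {0..})"
      by simp
  next
    fix r assume r: "r \<in> {0<..<t}"
    then have r0: "0 \<le> r" "r \<le> t" by auto
    have "\<bar>Q r\<bar> \<le> N * \<delta>"
    proof (rule Q_abs_le[OF r0(1)])
      fix k :: nat assume k: "1 \<le> k"
      have pw: "\<bar>m x ^ k\<bar> \<le> \<delta>" if "0 \<le> x" "x \<le> r" for x
      proof -
        have "\<bar>m x\<bar> ^ k \<le> \<bar>m x\<bar> ^ 1" using k m_abs_le that by (intro power_decreasing) auto
        then show ?thesis using m[of x] that r0 by (simp add: power_abs)
      qed
      have "q k r \<le> (A k)\<^sup>2 * \<delta>" using pw \<delta>(1) r0 by (intro q_upper) (auto simp: abs_le_iff)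
      moreover have "- ((A k)\<^sup>2 * \<delta>) \<le> q k r"
        using pw \<delta>(1) r0 by (intro q_lower) (force simp: abs_le_iff)+
      ultimately show "\<bar>q k r\<bar> \<le> (A k)\<^sup>2 * \<delta>" by simp
    qed
    moreover have "e0 / 4 \<le> exp (- r) * P r"
    proof -
      have "M * \<bar>m r\<bar> \<le> M * \<delta>" using m[OF r0] init_const_nonneg by (intro mult_left_mono) auto
      then have P: "3 / 4 * e0 \<le> P r" using P_ge[OF r0(1)] e0 \<delta>(3) by linarith
      have "exp r \<le> exp 1" using r0 assms by simp
      then have "exp r \<le> 3" using exp_le by linarith
      then have "1 / 3 \<le> exp (- r)" by (simp add: exp_minus field_simps)
      then have "1 / 3 * (3 / 4 * e0) \<le> exp (- r) * P r" using P e0 by (intro mult_mono) auto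
      then show ?thesis by simp
    qed
    \<comment> \<open>The constants are \<open>1 / 4 - 1 / 40 = 9 / 40\<close>, and
      \<open>3 / 4 * (9 / 40)\<close> still exceeds \<open>1 / 8\<close>.\<close>
    ultimately have S: "9 / 40 * e0 \<le> S r" unfolding S_decompose[OF r0(1)] using \<delta>(4) by linarith
    have "\<bar>m r\<bar>\<^sup>2 \<le> (1 / 2)\<^sup>2" using m[OF r0] \<delta>(2) by (intro power_mono) auto
    then have "3 / 4 \<le> 1 - (m r)\<^sup>2" by (simp add: power2_eq_square)
    then have "3 / 4 * (9 / 40 * e0) \<le> (1 - (m r)\<^sup>2) * S r" using S e0 by (intro mult_mono) auto
    then show "0 \<le> (1 - (m r)\<^sup>2) * S r - e0 / 8" using e0 by simp
  qed
  then show ?thesis by simp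
qed

text \<open>When \<open>\<bar>m\<bar>\<close> first equals \<open>\<delta>\<close>, growth excludes
  the value \<open>- \<delta>\<close>. If this never happened up to time 1, growth from above
  \<open>- \<delta>\<close> by \<open>e0 / 8 \<ge> 2 * \<delta>\<close> would carry \<open>m\<close>
  past \<open>\<delta>\<close>.\<close>

lemma reaches_\<delta>: "\<exists>t1. 0 \<le> t1 \<and> t1 \<le> 1 \<and> m t1 = \<delta> \<and> (\<forall>r. 0 \<le> r \<longrightarrow> r \<le> t1 \<longrightarrow> \<bar>m r\<bar> \<le> \<delta>)"
proof (cases "\<exists>t. 0 \<le> t \<and> t \<le> 1 \<and> \<delta> \<le> \<bar>m t\<bar>")
  case True
  then obtain t where t: "0 \<le> t" "t \<le> 1" "\<delta> \<le> \<bar>m t\<bar>" by blast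
  have "continuous_on {0..} (\<lambda>t. - \<bar>m t\<bar>)" by (intro continuous_intros m_continuous)
  then obtain \<sigma> where \<sigma>: "0 < \<sigma>" "\<sigma> \<le> t" "- \<bar>m \<sigma>\<bar> = - \<delta>"
      "\<And>r. 0 \<le> r \<Longrightarrow> r < \<sigma> \<Longrightarrow> - \<delta> < - \<bar>m r\<bar>"
    using first_time_le[of 0 "\<lambda>t. - \<bar>m t\<bar>" "- \<delta>" t] t m_0_small by auto
  have le: "\<bar>m r\<bar> \<le> \<delta>" if "0 \<le> r" "r \<le> \<sigma>" for r
    using \<sigma>(3) \<sigma>(4)[of r] that by (cases "r = \<sigma>") auto
  have "m 0 + e0 / 8 * \<sigma> \<le> m \<sigma>" using \<sigma> t le by (intro growth) auto
  moreover have "0 \<le> e0 / 8 * \<sigma>" using e0 \<sigma> by simp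
  ultimately have "- \<delta> < m \<sigma>" using m_0_small by linarith
  then have "m \<sigma> = \<delta>" using \<sigma>(3) by linarith
  then show ?thesis using \<sigma> t le by (intro exI[of _ \<sigma>]) auto
next
  case False
  then have less: "\<bar>m t\<bar> < \<delta>" if "0 \<le> t" "t \<le> 1" for t using that by force
  have "m 0 + e0 / 8 * 1 \<le> m 1" using less by (intro growth) (auto intro: less_imp_le)
  then have "\<delta> \<le> m 1" using m_0_small \<delta>(5) by linarith
  then show ?thesis using less[of 1] by simp
qed

section \<open>Staying above the level \<delta>\<close>

definition t1 :: real where
  "t1 = (SOME t1. 0 \<le> t1 \<and> t1 \<le> 1 \<and> m t1 = \<delta> \<and> (\<forall>r. 0 \<le> r \<longrightarrow> r \<le> t1 \<longrightarrow> \<bar>m r\<bar> \<le> \<delta>))"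

lemma t1: "0 \<le> t1" "t1 \<le> 1" "m t1 = \<delta>"
  and m_before_t1: "0 \<le> r \<Longrightarrow> r \<le> t1 \<Longrightarrow> \<bar>m r\<bar> \<le> \<delta>"
  using someI_ex[OF reaches_\<delta>] unfolding t1_def[symmetric] by auto

text \<open>Before \<open>t1\<close> the overlap may be negative, so \<open>q k\<close> may have
  gone negative as well, but only to order \<open>\<delta>\<close>.\<close>

lemma q_t1_ge: "1 \<le> k \<Longrightarrow> - ((A k)\<^sup>2 * \<delta>) \<le> q k t1"
proof (rule q_lower[OF t1(1)])
  fix r assume k: "1 \<le> k" and r: "0 \<le> r" "r \<le> t1"
  have "\<bar>m r\<bar> ^ k \<le> \<bar>m r\<bar> ^ 1" using k m_abs_le r by (intro power_decreasing) auto
  then have "\<bar>m r ^ k\<bar> \<le> \<delta>" using m_before_t1[OF r] by (simp add: power_abs)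
  then show "- \<delta> \<le> m r ^ k" by linarith
qed (use \<delta> in auto)

text \<open>Relaxation forgets the possibly negative value at \<open>t1\<close> exponentially. It is
  used with \<open>l = 0\<close> to limit the damage and with \<open>l = \<delta>\<close> to obtain
  a positive limit.\<close>

lemma q_after_t1:
  assumes "1 \<le> k" "t1 \<le> t" and l: "0 \<le> l" "\<And>r. t1 \<le> r \<Longrightarrow> r \<le> t \<Longrightarrow> l \<le> m r"
  shows "(A k)\<^sup>2 * l ^ k - exp (- (t - t1)) * ((A k)\<^sup>2 * (\<delta> + l ^ k)) \<le> q k t"
proof -
  have "(A k)\<^sup>2 * l ^ k + exp (- (t - t1)) * (q k t1 - (A k)\<^sup>2 * l ^ k) \<le> q k t"
  proof (rule relaxation_lower_bound[OF t1(1) assms(2) q_deriv])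
    fix r assume "r \<in> {t1<..<t}"
    then show "(A k)\<^sup>2 * l ^ k \<le> (A k)\<^sup>2 * m r ^ k"
      using l by (intro mult_left_mono power_mono) auto
  qed (use t1 in auto)
  moreover have "exp (- (t - t1)) * (- ((A k)\<^sup>2 * \<delta>) - (A k)\<^sup>2 * l ^ k)
      \<le> exp (- (t - t1)) * (q k t1 - (A k)\<^sup>2 * l ^ k)"
    using q_t1_ge[OF assms(1)] by (intro mult_left_mono) auto
  ultimately show ?thesis by (simp add: algebra_simps)
qed

lemma exp_after_t1: "exp (- (t - t1)) \<le> 3 * exp (- t)"
proof -
  have "exp t1 \<le> exp 1" using t1 by simp
  then have "exp t1 \<le> 3" using exp_le by linarith
  then have "exp t1 * exp (- t) \<le> 3 * exp (- t)" by (intro mult_right_mono) auto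
  then show ?thesis by (simp add: exp_add[symmetric])
qed

text \<open>The case \<open>l = 0\<close> of the previous bound controls the negative parts; as
  \<open>t1 \<le> 1\<close>, rewriting their decay from \<open>t1\<close> as decay from 0 costs a
  factor 3.\<close>

lemma Q_after_t1:
  assumes "t1 \<le> t" and m: "\<And>r. t1 \<le> r \<Longrightarrow> r \<le> t \<Longrightarrow> 0 \<le> m r"
  shows "q 1 t - 3 * exp (- t) * (N * \<delta>) \<le> Q t"
proof -
  have "q 1 t - N * (exp (- (t - t1)) * \<delta>) \<le> Q t"
  proof (rule Q_ge)
    fix k :: nat assume "1 \<le> k"
    then show "- ((A k)\<^sup>2 * (exp (- (t - t1)) * \<delta>)) \<le> q k t"
      using q_after_t1[of k t 0] assms by (simp add: mult_ac power_0_left)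
  qed (use assms t1 \<delta> in auto)
  moreover have "exp (- (t - t1)) * (N * \<delta>) \<le> 3 * exp (- t) * (N * \<delta>)"
    using drive_const_nonneg \<delta>(1) by (intro mult_right_mono exp_after_t1) auto
  ultimately show ?thesis by (simp add: mult_ac)
qed

lemma A1_square_le: "(A 1)\<^sup>2 \<le> N"
  using drive_const_ge[of 0] by simp

text \<open>At a first descent below \<open>\<delta>\<close> the positive term in \<open>P\<close>
  and the negative remainders in \<open>Q\<close> carry the same factor \<open>exp (- t)\<close>.
  Their comparison is therefore independent of the time, and the velocity is positive.\<close>

lemma m_ge_\<delta>:
  assumes "t1 \<le> t"
  shows "\<delta> \<le> m t"
proof (rule ccontr)
  assume "\<not> \<delta> \<le> m t"
  \<comment> \<open>The level must lie strictly below \<open>m t1 = \<delta>\<close> for a first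
    passage to exist, and it must stay positive for \<open>Q_after_t1\<close>.\<close>
  define d where "d = max (m t) (\<delta> / 2)"
  have d: "0 < d" "d < \<delta>" "m t \<le> d" using \<open>\<not> \<delta> \<le> m t\<close> \<delta>(1) by (auto simp: d_def)
  have "continuous_on {t1..} m" by (rule continuous_on_subset[OF m_continuous]) (use t1 in auto)
  then obtain \<sigma> where \<sigma>: "t1 < \<sigma>" "\<sigma> \<le> t" "m \<sigma> = d" "\<And>r. t1 \<le> r \<Longrightarrow> r < \<sigma> \<Longrightarrow> d < m r"
    using first_time_le[of t1 m d t] t1 d assms by auto
  have nn: "0 \<le> m r" if "t1 \<le> r" "r \<le> \<sigma>" for r
    using \<sigma>(3) \<sigma>(4)[of r] d that by (cases "r = \<sigma>") auto
  have \<sigma>0: "0 < \<sigma>" using \<sigma> t1 by simp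
  have "- (3 * exp (- \<sigma>) * (N * \<delta>)) \<le> q 1 \<sigma>"
  proof -
    have "exp (- (\<sigma> - t1)) * ((A 1)\<^sup>2 * \<delta>) \<le> 3 * exp (- \<sigma>) * (N * \<delta>)"
      using \<delta>(1) by (intro mult_mono exp_after_t1 mult_right_mono A1_square_le) auto
    then show ?thesis using q_after_t1[of 1 \<sigma> 0] nn \<sigma>(1) by simp
  qed
  then have "- (6 * exp (- \<sigma>) * (N * \<delta>)) \<le> Q \<sigma>" using Q_after_t1[of \<sigma>] nn \<sigma>(1) by simp
  moreover have "exp (- \<sigma>) * (N * \<delta>) \<le> exp (- \<sigma>) * (e0 / 40)"
    using \<delta>(4) by (intro mult_left_mono) auto
  moreover have "exp (- \<sigma>) * (3 / 4 * e0) \<le> exp (- \<sigma>) * P \<sigma>"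
  proof (intro mult_left_mono)
    have "M * d \<le> M * \<delta>" using d init_const_nonneg by (intro mult_left_mono) auto
    then show "3 / 4 * e0 \<le> P \<sigma>" using P_ge[of \<sigma>] \<sigma>0 \<sigma>(3) d e0 \<delta>(3) by simp
  qed simp
  moreover have "0 < exp (- \<sigma>) * e0" using e0 by simp
  \<comment> \<open>The total is at least
    \<open>(3 / 4 - 6 / 40) * exp (- \<sigma>) * e0\<close>.\<close>
  ultimately have "0 < S \<sigma>"
    unfolding S_decompose[OF less_imp_le[OF \<sigma>0]] mult.left_commute[of _ "3 / 4"]
      times_divide_eq_right mult.assoc by linarith
  moreover have "d\<^sup>2 < 1\<^sup>2" using d \<delta>(2) by (intro power_strict_mono) auto
  ultimately have pos: "0 < (1 - (m \<sigma>)\<^sup>2) * S \<sigma>" using \<sigma>(3) by simp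
  have "(m has_real_derivative (1 - (m \<sigma>)\<^sup>2) * S \<sigma>) (at \<sigma> within {0<..})"
    by (rule DERIV_subset[OF m_deriv]) (use \<sigma>0 in auto)
  then have "(m has_real_derivative (1 - (m \<sigma>)\<^sup>2) * S \<sigma>) (at \<sigma>)"
    using \<sigma>0 by (simp add: at_within_open[of \<sigma> "{0<..}"])
  from DERIV_pos_inc_left[OF this pos] obtain h where h: "0 < h" "\<And>x. 0 < x \<Longrightarrow> x < h \<Longrightarrow> m (\<sigma> - x) < m \<sigma>"
    by auto
  \<comment> \<open>Small enough for the local increase at \<open>\<sigma>\<close>, and not reaching
    back before \<open>t1\<close>.\<close>
  define x where "x = min (h / 2) (\<sigma> - t1)"
  have "m (\<sigma> - x) < m \<sigma>" using h \<sigma>(1) by (auto simp: x_def)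
  moreover have "d < m (\<sigma> - x)" using h \<sigma> by (intro \<sigma>(4)) (auto simp: x_def min_def)
  ultimately show False using \<sigma>(3) by simp
qed

text \<open>With \<open>m \<ge> \<delta>\<close> secured, \<open>q 1\<close> supplies
  \<open>(A 1)\<^sup>2 * \<delta>\<close>. The errors add up to
  \<open>exp (- t) * (M + 9 * (N * \<delta>))\<close>: \<open>M\<close> from \<open>P\<close>, six
  parts from \<open>q 1\<close> and three from \<open>Q\<close>. The choice of \<open>D\<close> lets
  them consume at most half.\<close>

lemma S_ge:
  assumes D: "1 \<le> D" "exp (- D) * (M + 9 * (N * \<delta>)) \<le> (A 1)\<^sup>2 * \<delta> / 2" and "D \<le> t"
  shows "(A 1)\<^sup>2 * \<delta> / 2 \<le> S t"
proof -
  have t: "t1 \<le> t" "0 \<le> t" using t1 assms by auto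
  have "q 1 t \<ge> (A 1)\<^sup>2 * \<delta> - 6 * exp (- t) * (N * \<delta>)"
  proof -
    have "exp (- (t - t1)) * ((A 1)\<^sup>2 * (\<delta> + \<delta>)) \<le> 3 * exp (- t) * (N * (\<delta> + \<delta>))"
      using \<delta>(1) by (intro mult_mono exp_after_t1 mult_right_mono A1_square_le) auto
    moreover have "3 * exp (- t) * (N * (\<delta> + \<delta>)) = 6 * exp (- t) * (N * \<delta>)" by simp
    moreover have "(A 1)\<^sup>2 * \<delta> ^ 1 - exp (- (t - t1)) * ((A 1)\<^sup>2 * (\<delta> + \<delta> ^ 1)) \<le> q 1 t"
      using m_ge_\<delta> t \<delta>(1) by (intro q_after_t1) auto
    ultimately show ?thesis unfolding power_one_right by linarith
  qed
  moreover have "q 1 t - 3 * exp (- t) * (N * \<delta>) \<le> Q t"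
    using t by (intro Q_after_t1) (auto intro: order_trans[OF less_imp_le[OF \<delta>(1)] m_ge_\<delta>])
  moreover have "exp (- t) * (- M) \<le> exp (- t) * P t"
  proof (intro mult_left_mono)
    have "\<bar>P t\<bar> \<le> M * \<bar>m t\<bar> ^ (1 - 1)" using t by (intro P_abs_le) auto
    then show "- M \<le> P t" by simp
  qed simp
  moreover have "exp (- t) * (M + 9 * (N * \<delta>)) \<le> exp (- D) * (M + 9 * (N * \<delta>))"
    using assms init_const_nonneg drive_const_nonneg \<delta>(1) by (intro mult_right_mono) auto
  ultimately show ?thesis
    unfolding S_decompose[OF t(2)] using D(2) by (simp add: algebra_simps)
qed

lemma linear_converge:
  assumes D: "1 \<le> D" "exp (- D) * (M + 9 * (N * \<delta>)) \<le> (A 1)\<^sup>2 * \<delta> / 2"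
    and c: "0 \<le> c" "c \<le> (A 1)\<^sup>2 * \<delta> / 2" "c \<le> 1 / 2" and "0 \<le> t"
  shows "1 - m t \<le> 2 * exp D * exp (- c * t)"
    and "\<bar>a k t - A k\<bar> \<le> 4 * exp D * profile A k * exp (- c * t)"
proof -
  have "A 1 \<noteq> 0" using e0 by auto
  then have A1: "0 < (A 1)\<^sup>2 * \<delta> / 2" using \<delta>(1) by simp
  \<comment> \<open>The decay starts at time 0 with delay \<open>D\<close>, which also covers the
    initial stretch up to \<open>t1 \<le> 1\<close>.\<close>
  have m: "1 - m r \<le> 2 * exp D * exp (- c * (r - 0))" if "0 \<le> r" for r
  proof (rule one_minus_m_decay[OF order_refl _ A1])
    fix t assume "0 + D \<le> t"
    then show "(A 1)\<^sup>2 * \<delta> / 2 \<le> S t" "0 \<le> m t"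
      using S_ge[OF D] m_ge_\<delta>[of t] D(1) t1 \<delta>(1) by auto
  qed (use D(1) c that in auto)
  show "1 - m t \<le> 2 * exp D * exp (- c * t)" using m[OF \<open>0 \<le> t\<close>] by simp
  have "(1::real) \<le> 2 * exp D" using exp_ge_add_one_self[of D] D(1) by linarith
  from a_decay[OF order_refl c(1,3) this m \<open>0 \<le> t\<close>]
  show "\<bar>a k t - A k\<bar> \<le> 4 * exp D * profile A k * exp (- c * t)" by simp
qed

end

section \<open>Dimension-free convergence\<close>

text \<open>The conclusion for \<open>s \<ge> 2\<close> with all constants as parameters, phrased so
  that it folds directly in the final statement.\<close>

definition escapes_and_converges ::
  "(nat \<Rightarrow> real) \<Rightarrow> nat \<Rightarrow> real \<Rightarrow> real \<Rightarrow> real \<Rightarrow> real \<Rightarrow> nat \<Rightarrow> (nat \<Rightarrow> real)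
    \<Rightarrow> (real \<Rightarrow> real) \<Rightarrow> (nat \<Rightarrow> real \<Rightarrow> real) \<Rightarrow> bool" where
  "escapes_and_converges A s \<kappa> c C C' d b m a \<longleftrightarrow>
    (\<exists>\<tau>. hitting_time \<kappa> m = ereal \<tau> \<and> \<tau> \<ge> C' * real d ^ (s - 1) \<and>
      (\<forall>t\<ge>\<tau>.
        (m 0 > 0 \<longrightarrow> \<bar>1 - m t\<bar> \<le> C * exp (- c * (t - \<tau>)) \<and>
          (\<forall>k. \<bar>a k t - A k\<bar> \<le> C * b k * exp (- c * (t - \<tau>)))) \<and>
        (m 0 < 0 \<longrightarrow> \<bar>1 + m t\<bar> \<le> C * exp (- c * (t - \<tau>)) \<and>
          (\<forall>k. \<bar>a k t - (-1) ^ k * A k\<bar> \<le> C * b k * exp (- c * (t - \<tau>))))))"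

definition converges_from_start ::
  "(nat \<Rightarrow> real) \<Rightarrow> real \<Rightarrow> real \<Rightarrow> (nat \<Rightarrow> real) \<Rightarrow> (real \<Rightarrow> real) \<Rightarrow> (nat \<Rightarrow> real \<Rightarrow> real) \<Rightarrow> bool" where
  "converges_from_start A c C b m a \<longleftrightarrow>
    (\<forall>t\<ge>0.
      (A 1 * a 1 0 > 0 \<longrightarrow> \<bar>1 - m t\<bar> \<le> C * exp (- c * t) \<and>
        (\<forall>k. \<bar>a k t - A k\<bar> \<le> C * b k * exp (- c * t))) \<and>
      (A 1 * a 1 0 < 0 \<longrightarrow> \<bar>1 + m t\<bar> \<le> C * exp (- c * t) \<and>
        (\<forall>k. \<bar>a k t - (-1) ^ k * A k\<bar> \<le> C * b k * exp (- c * t))))"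

context sobolev_coeffs
begin

lemma profile_norm_bound:
  assumes "x \<le> C * profile A k * y" "0 \<le> y"
  shows "x \<le> C * profile_norm * (profile A k / profile_norm) * y"
  using assms profile_norm_ge1 by simp

text \<open>Lets one constant serve both estimates: the coefficients come with twice the constant of
  \<open>m\<close>, times \<open>profile_norm\<close>.\<close>

lemma le_mult_profile_norm:
  assumes "x \<le> C * y" "0 \<le> C" "0 \<le> y"
  shows "x \<le> 2 * C * profile_norm * y"
proof -
  have "1 * C * y \<le> profile_norm * C * y"
    using assms profile_norm_ge1 by (intro mult_right_mono) auto
  moreover have "0 \<le> profile_norm * C * y"
    using assms profile_norm_ge1 by (intro mult_nonneg_nonneg) auto
  ultimately show ?thesis using assms(1) by (simp add: mult_ac)
qed

lemma convergence_superlinear: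
  assumes s: "2 \<le> s" "\<And>k. 1 \<le> k \<Longrightarrow> k < s \<Longrightarrow> A k = 0" "A s \<noteq> 0" and R: "0 < R"
  shows "\<exists>c>0. \<exists>C>0. \<exists>C'>0. \<exists>d0::nat. \<forall>d\<ge>d0. \<forall>m a. flow A m a \<and> m 0 \<noteq> 0 \<and> (m 0)\<^sup>2 \<le> R / real d \<longrightarrow>
    escapes_and_converges A s (1 / 2) c C C' d (\<lambda>k. profile A k / profile_norm) m a"
proof -
  \<comment> \<open>\<open>\<kappa>\<close> and \<open>v\<close> repeat \<open>K\<close> and
    \<open>speed (exp (- M) / 2)\<close> in terms of \<open>A\<close> and \<open>s\<close> alone, so
    they are fixed before \<open>d\<close>, \<open>m\<close> and \<open>a\<close>.\<close>
  define M where "M = init_const A"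
  define \<kappa> where "\<kappa> = drive_const A * exp (M * s)"
  define v where "v = (A s)\<^sup>2 * (exp (- M) / 2) ^ (2 * s - 1) / 4"
  define c where "c = min v (1 / 2)"
  define L where "L = R * exp (2 * M)"
  define p where "p = real (2 * s - 2)"
  \<comment> \<open>Chosen so that \<open>p * \<kappa> * C' * d ^ (s - 1)\<close> is half of
    \<open>(d / L) ^ (s - 1)\<close>, where \<open>L / d\<close> bounds
    \<open>(m 0 * exp M)\<^sup>2\<close>.\<close>
  define C' where "C' = 1 / (2 * p * \<kappa> * L ^ (s - 1))"
  have v: "0 < v" using s(3) by (simp add: v_def)
  have M: "0 \<le> M" unfolding M_def by (rule init_const_nonneg)
  have "0 < real (Suc (s - 1)) * (A (Suc (s - 1)))\<^sup>2" using s by simp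
  then have \<kappa>: "0 < \<kappa>" using drive_const_ge[of "s - 1"] unfolding \<kappa>_def by (simp del: of_nat_Suc)
  have L: "0 < L" using R by (simp add: L_def)
  have p: "0 < p" using s by (simp add: p_def)
  have C': "0 < C'" using \<kappa> L p by (simp add: C'_def)
  have c: "0 < c" "c \<le> v" "c \<le> 1 / 2" using v by (auto simp: c_def)
  define T where "T = ln (M / v + 1)"
  have T: "M * exp (- T) \<le> v"
    using M v by (simp add: T_def exp_minus exp_ln_iff add_nonneg_pos field_simps)
  \<comment> \<open>\<open>8 * L \<le> d\<close> leaves the other half for
    \<open>2 ^ (2 * s - 2)\<close> and forces \<open>m 0 < 1 / 2\<close>;
    \<open>T / C' \<le> d\<close> makes the escape time at least \<open>T\<close>.\<close>
  define d0 where "d0 = nat \<lceil>max (max 1 (8 * L)) (T / C')\<rceil>"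
  have pos: "\<exists>\<tau>. hitting_time (1 / 2) m = ereal \<tau> \<and> \<tau> \<ge> C' * real d ^ (s - 1) \<and>
      (\<forall>t\<ge>\<tau>. \<bar>1 - m t\<bar> \<le> 4 * exp 1 * profile_norm * exp (- c * (t - \<tau>)) \<and>
        (\<forall>k. \<bar>a k t - A k\<bar> \<le> 4 * exp 1 * profile_norm * (profile A k / profile_norm) * exp (- c * (t - \<tau>))))"
    if d: "d0 \<le> d" and fl: "flow A m a" and m0: "0 < m 0" "(m 0)\<^sup>2 \<le> R / real d" for d m a
  proof -
    interpret escaping_flow A m a s
      using fl s m0 by (simp add: escaping_flow_def escaping_flow_axioms_def)
    have "max (max 1 (8 * L)) (T / C') \<le> real d"
      using d unfolding d0_def by (simp add: nat_le_iff ceiling_le_iff)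
    then have dd: "1 \<le> real d" "8 * L \<le> real d" "T \<le> C' * real d"
      using C' by (auto simp: field_simps)
    let ?B = "C' * real d ^ (s - 1)"
    have "real d ^ 1 \<le> real d ^ (s - 1)" using dd s by (intro power_increasing) auto
    then have "C' * real d ^ 1 \<le> ?B" using C' by (intro mult_left_mono) auto
    then have TB: "T \<le> ?B" using dd by simp
    have x: "(m 0 * exp M)\<^sup>2 \<le> L / real d"
      using mult_right_mono[OF m0(2), of "exp (2 * M)"]
      by (simp add: L_def power_mult_distrib exp_double[symmetric] M_def)
    have "R * 1 \<le> L" unfolding L_def using R M by (intro mult_left_mono) auto
    then have "R / real d \<le> 1 / 8" using dd by (simp add: field_simps)
    then have "(m 0)\<^sup>2 \<le> 1 / 8" using m0 by linarith
    moreover have "(1 / 2)\<^sup>2 = (1 / 4 :: real)" by (simp add: power2_eq_square)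
    ultimately have "(m 0)\<^sup>2 < (1 / 2)\<^sup>2" by linarith
    then have half: "m 0 < 1 / 2" by (rule power2_less_imp_less) simp
    have key: "2 ^ (2 * s - 2) + p * \<kappa> * ?B \<le> inverse ((m 0 * exp M) ^ (2 * s - 2))"
    proof -
      have e: "2 * s - 2 = 2 * (s - 1)" by simp
      have "(m 0 * exp M) ^ (2 * s - 2) \<le> (L / real d) ^ (s - 1)"
        unfolding e power_mult by (intro power_mono x) auto
      then have "inverse ((L / real d) ^ (s - 1)) \<le> inverse ((m 0 * exp M) ^ (2 * s - 2))"
        using m0 by (intro le_imp_inverse_le) auto
      moreover have "inverse ((L / real d) ^ (s - 1)) = (real d / L) ^ (s - 1)"
        by (simp add: power_divide)
      moreover have "p * \<kappa> * ?B = (real d / L) ^ (s - 1) / 2"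
        using p \<kappa> L by (simp add: C'_def power_divide)
      moreover have "2 ^ (2 * s - 2) \<le> (real d / L) ^ (s - 1) / 2"
      proof -
        have "(8::real) ^ (s - 1) \<le> (real d / L) ^ (s - 1)"
          using dd L by (intro power_mono) (auto simp: field_simps)
        \<comment> \<open>\<open>8 = 2 * 2\<^sup>2\<close>; the spare factor
          \<open>2 ^ (s - 1) \<ge> 2\<close> pays for the division by 2.\<close>
        moreover have "(8::real) ^ (s - 1) = 2 ^ (s - 1) * 2 ^ (2 * s - 2)"
          unfolding e power_mult by (simp add: power_mult_distrib[symmetric])
        moreover have "(2::real) ^ 1 \<le> 2 ^ (s - 1)" using s by (intro power_increasing) auto
        then have "(2::real) ^ 1 * 2 ^ (2 * s - 2) \<le> 2 ^ (s - 1) * 2 ^ (2 * s - 2)"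
          by (intro mult_right_mono) auto
        ultimately show ?thesis unfolding power_one_right by linarith
      qed
      ultimately show ?thesis by linarith
    qed
    have B: "0 < ?B" using C' dd by simp
    obtain \<tau> where \<tau>: "hitting_time (1 / 2) m = ereal \<tau>" "?B \<le> \<tau>"
      and dec: "\<And>t. \<tau> \<le> t \<Longrightarrow> 1 - m t \<le> 2 * exp 1 * exp (- c * (t - \<tau>))"
        "\<And>t k. \<tau> \<le> t \<Longrightarrow> \<bar>a k t - A k\<bar> \<le> 4 * exp 1 * profile A k * exp (- c * (t - \<tau>))"
    proof -
      have v_eq: "v = speed (exp (- init_const A) / 2)" by (simp add: speed_def v_def M_def)
      have "\<kappa> = K" by (simp add: \<kappa>_def K_def M_def)
      from escape_and_converge[OF half T[unfolded M_def v_eq] TB B key[unfolded p_def this M_def]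
          less_imp_le[OF c(1)] c(2)[unfolded v_eq] c(3)]
      show ?thesis using that by blast
    qed
    have "\<bar>1 - m t\<bar> \<le> 4 * exp 1 * profile_norm * exp (- c * (t - \<tau>))" if t: "\<tau> \<le> t" for t
    proof -
      have "0 \<le> 1 - m t" using m_bounds[of t] t \<tau>(2) B by simp
      then show ?thesis using le_mult_profile_norm[OF dec(1)[OF t]] by simp
    qed
    then show ?thesis using \<tau> profile_norm_bound[OF dec(2)] by (intro exI[of _ \<tau>]) auto
  qed
  have C: "0 < 4 * exp 1 * profile_norm" using profile_norm_ge1 by simp
  show ?thesis
  proof (rule exI[of _ c], rule conjI[OF c(1)], rule exI[of _ "4 * exp 1 * profile_norm"],
      rule conjI[OF C], rule exI[of _ C'], rule conjI[OF C'], rule exI[of _ d0], intro allI impI)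
    fix d m a assume d: "d0 \<le> d" and asm: "flow A m a \<and> m 0 \<noteq> 0 \<and> (m 0)\<^sup>2 \<le> R / real d"
    show "escapes_and_converges A s (1 / 2) c (4 * exp 1 * profile_norm) C' d
        (\<lambda>k. profile A k / profile_norm) m a"
    proof (cases "0 < m 0")
      case True
      then show ?thesis using pos[OF d, of m a] asm by (auto simp: escapes_and_converges_def)
    next
      case False
      have "\<bar>(-1) ^ k * a k t - A k\<bar> = \<bar>a k t - (-1) ^ k * A k\<bar>" for k t
        by (cases "even k") auto
      moreover have "hitting_time (1 / 2) (\<lambda>t. - m t) = hitting_time (1 / 2) m"
        by (simp add: hitting_time_def)
      ultimately show ?thesis
        using pos[OF d flow_reflect, of m a] asm False by (auto simp: escapes_and_converges_def)
    qed
  qed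
qed

lemma convergence_linear:
  assumes e: "0 < e"
  shows "\<exists>c>0. \<exists>C>0. \<exists>\<delta>>0. \<forall>m a. flow A m a \<and> \<bar>m 0\<bar> < \<delta> \<and> e \<le> \<bar>A 1 * a 1 0\<bar> \<longrightarrow>
    converges_from_start A c C (\<lambda>k. profile A k / profile_norm) m a"
proof (cases "A 1 = 0")
  case True
  \<comment> \<open>The hypothesis \<open>e \<le> \<bar>A 1 * a 1 0\<bar>\<close> is contradictory
    here, so any constants do.\<close>
  then show ?thesis using e by (intro exI[of _ 1]) (auto simp: converges_from_start_def)
next
  case False
  define M where "M = init_const A"
  define N where "N = drive_const A"
  \<comment> \<open>The denominator yields \<open>40 * (1 + M + N) * \<delta> \<le> e\<close>, which
    implies all three smallness conditions of \<open>linear_flow\<close>.\<close>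
  define \<delta> where "\<delta> = min (1 / 2) (e / (40 * (1 + M + N)))"
  define v where "v = (A 1)\<^sup>2 * \<delta> / 2"
  define c where "c = min v (1 / 2)"
  \<comment> \<open>The logarithm makes the transient at most \<open>v\<close>; its summand 1 keeps
    the argument positive.\<close>
  define D where "D = max 1 (ln ((M + 9 * (N * \<delta>)) / v + 1))"
  define C where "C = 4 * exp D * profile_norm"
  have MN: "0 \<le> M" "0 \<le> N" unfolding M_def N_def by (rule init_const_nonneg drive_const_nonneg)+
  have \<delta>: "0 < \<delta>" "\<delta> \<le> 1 / 2"
    using e MN unfolding \<delta>_def by (simp, intro min.cobounded1)
  have "\<delta> \<le> e / (40 * (1 + M + N))" by (simp add: \<delta>_def)
  then have *: "\<delta> * 40 + (M * \<delta>) * 40 + (N * \<delta>) * 40 \<le> e"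
    using MN by (simp add: field_simps)
  moreover have "0 \<le> M * \<delta>" "0 \<le> N * \<delta>" using MN \<delta> by auto
  ultimately have \<delta>': "M * \<delta> \<le> e / 4" "N * \<delta> \<le> e / 40" "16 * \<delta> \<le> e"
    using \<delta> by auto
  have v: "0 < v" using False \<delta> by (simp add: v_def)
  have c: "0 < c" "c \<le> v" "c \<le> 1 / 2" using v by (auto simp: c_def)
  have D: "1 \<le> D" "exp (- D) * (M + 9 * (N * \<delta>)) \<le> v"
  proof -
    let ?x = "M + 9 * (N * \<delta>)"
    have x: "0 \<le> ?x" using MN \<delta> by simp
    have "?x / v + 1 = exp (ln (?x / v + 1))" using x v by (simp add: exp_ln_iff add_nonneg_pos)
    also have "\<dots> \<le> exp D" by (simp add: D_def)
    finally have "?x \<le> exp D * v" using v by (simp add: field_simps)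
    then show "exp (- D) * ?x \<le> v" by (simp add: exp_minus field_simps)
  qed (simp add: D_def)
  have pos: "\<bar>1 - m t\<bar> \<le> C * exp (- c * t) \<and>
      (\<forall>k. \<bar>a k t - A k\<bar> \<le> C * (profile A k / profile_norm) * exp (- c * t))"
    if fl: "flow A m a" and m0: "\<bar>m 0\<bar> < \<delta>" "e \<le> A 1 * a 1 0" and t: "0 \<le> t" for m a t
  proof -
    interpret linear_flow A m a e \<delta>
      using fl m0 e \<delta> \<delta>' unfolding M_def N_def by (simp add: linear_flow_def linear_flow_axioms_def)
    have D': "exp (- D) * (init_const A + 9 * (drive_const A * \<delta>)) \<le> (A 1)\<^sup>2 * \<delta> / 2"
      using D(2) by (simp add: M_def N_def v_def)
    note conv = linear_converge[OF D(1) D' less_imp_le[OF c(1)] c(2)[unfolded v_def] c(3) t]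
    have "0 \<le> 1 - m t" using m_bounds[OF t] by simp
    then show ?thesis unfolding C_def
      using le_mult_profile_norm[OF conv(1)] profile_norm_bound[OF conv(2)] by simp
  qed
  have C: "0 < C" using profile_norm_ge1 by (simp add: C_def)
  show ?thesis
  proof (rule exI[of _ c], rule conjI[OF c(1)], rule exI[of _ C], rule conjI[OF C],
      rule exI[of _ \<delta>], rule conjI[OF \<delta>(1)], intro allI)
    fix m a
    show "flow A m a \<and> \<bar>m 0\<bar> < \<delta> \<and> e \<le> \<bar>A 1 * a 1 0\<bar> \<longrightarrow>
    converges_from_start A c C (\<lambda>k. profile A k / profile_norm) m a"
      unfolding converges_from_start_def
    proof (intro impI allI conjI)
      have sgn: "\<bar>(-1) ^ k * a k t - A k\<bar> = \<bar>a k t - (-1) ^ k * A k\<bar>" for k t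
        by (cases "even k") auto
      fix t :: real
      assume asm: "flow A m a \<and> \<bar>m 0\<bar> < \<delta> \<and> e \<le> \<bar>A 1 * a 1 0\<bar>" and t: "0 \<le> t"
      show "\<bar>1 - m t\<bar> \<le> C * exp (- c * t)" if "A 1 * a 1 0 > 0"
        using pos[of m a t] asm t that by auto
      show "\<bar>a k t - A k\<bar> \<le> C * (profile A k / profile_norm) * exp (- c * t)" if "A 1 * a 1 0 > 0" for k
        using pos[of m a t] asm t that by auto
      \<comment> \<open>Reflection flips the sign of \<open>a 1 0\<close>, so the positive case
        applies to the reflected flow.\<close>
      show "\<bar>1 + m t\<bar> \<le> C * exp (- c * t)" if "A 1 * a 1 0 < 0"
        using pos[OF flow_reflect, of m a t] asm t that by auto
      show "\<bar>a k t - (-1) ^ k * A k\<bar> \<le> C * (profile A k / profile_norm) * exp (- c * t)"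
        if "A 1 * a 1 0 < 0" for k
        using pos[OF flow_reflect, of m a t] asm t that unfolding sgn by auto
    qed
  qed
qed

end

section \<open>The random initialization\<close>

interpretation lborel_product: product_sigma_finite "\<lambda>_::nat. lborel :: real measure"
  by standard

lemma space_lborel_d: "space (lborel_d d) = {..<d} \<rightarrow>\<^sub>E UNIV"
  by (simp add: lborel_d_def space_PiM)

lemma measurable_component_d [measurable]:
  "i < d \<Longrightarrow> (\<lambda>x. x i) \<in> borel_measurable (lborel_d d)"
  unfolding lborel_d_def using measurable_component_singleton[of i "{..<d}" "\<lambda>_. lborel :: real measure"]
  by simp

lemma measurable_L2_set_d [measurable]: "(\<lambda>x. L2_set x {..<d}) \<in> borel_measurable (lborel_d d)"
  unfolding L2_set_def by measurable

lemma measurable_dot_d [measurable]: "(\<lambda>x. dot d x w) \<in> borel_measurable (lborel_d d)"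
  unfolding dot_def by measurable

lemma measurable_into_d:
  "(\<And>i. i < d \<Longrightarrow> f i \<in> borel_measurable M) \<Longrightarrow> (\<lambda>x. \<lambda>i\<in>{..<d}. f i x) \<in> measurable M (lborel_d d)"
  unfolding lborel_d_def by (intro measurable_restrict) auto

lemma normalize_d_measurable [measurable]: "normalize_d d \<in> measurable (lborel_d d) (lborel_d d)"
proof -
  have "(\<lambda>x. \<lambda>i\<in>{..<d}. x i / L2_set x {..<d}) \<in> measurable (lborel_d d) (lborel_d d)"
    by (intro measurable_into_d) measurable
  then show ?thesis by (simp add: normalize_d_def[abs_def])
qed

lemma unit_ball_d_eq: "unit_ball_d d = {x \<in> space (lborel_d d). L2_set x {..<d} \<le> 1}"
  by (simp add: unit_ball_d_def space_lborel_d)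

lemma sets_unit_ball_d [measurable]: "unit_ball_d d \<in> sets (lborel_d d)"
  unfolding unit_ball_d_eq by measurable

lemma abs_le_L2_set: "finite I \<Longrightarrow> i \<in> I \<Longrightarrow> \<bar>x i\<bar> \<le> L2_set x I"
  using member_le_L2_set[of I i "\<lambda>i. \<bar>x i\<bar>"] by (simp add: L2_set_def)

text \<open>The ball lies between the cubes of half side \<open>1 / d\<close> and 1. Both bounds are
  what \<open>uniform_measure\<close> needs to be a probability.\<close>

lemma emeasure_unit_ball_d:
  assumes "0 < d"
  shows "emeasure (lborel_d d) (unit_ball_d d) \<noteq> 0" "emeasure (lborel_d d) (unit_ball_d d) \<noteq> \<infinity>"
proof -
  have box: "emeasure (lborel_d d) ({..<d} \<rightarrow>\<^sub>E {-r..r}) = ennreal (2 * r) ^ d"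
    "({..<d} \<rightarrow>\<^sub>E {-r..r}) \<in> sets (lborel_d d)" if "0 \<le> r" for r :: real
    using that unfolding lborel_d_def
    by (auto simp: lborel_product.emeasure_PiM intro!: sets_PiM_I_finite)
  have "({..<d} \<rightarrow>\<^sub>E {-(1 / real d)..1 / real d}) \<subseteq> unit_ball_d d"
  proof
    fix x assume x: "x \<in> {..<d} \<rightarrow>\<^sub>E {-(1 / real d)..1 / real d}"
    have "L2_set x {..<d} \<le> (\<Sum>i<d. \<bar>x i\<bar>)" by (rule L2_set_le_sum_abs)
    also have "\<dots> \<le> (\<Sum>i<d. 1 / real d)"
      using x by (intro sum_mono) (fastforce simp: abs_le_iff PiE_iff)
    also have "\<dots> = 1" using assms by simp
    finally show "x \<in> unit_ball_d d" using x by (auto simp: unit_ball_d_def PiE_iff)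
  qed
  then have "ennreal (2 * (1 / real d)) ^ d \<le> emeasure (lborel_d d) (unit_ball_d d)"
    by (subst box(1)[symmetric]) (auto intro!: emeasure_mono)
  moreover have "0 < ennreal (2 * (1 / real d)) ^ d" using assms by (simp add: ennreal_power)
  ultimately show "emeasure (lborel_d d) (unit_ball_d d) \<noteq> 0" by auto
  have "unit_ball_d d \<subseteq> ({..<d} \<rightarrow>\<^sub>E {-1..1})"
  proof
    fix x assume x: "x \<in> unit_ball_d d"
    have "\<bar>x i\<bar> \<le> 1" if "i < d" for i
      using abs_le_L2_set[of "{..<d}" i x] x that by (simp add: unit_ball_d_def)
    then show "x \<in> {..<d} \<rightarrow>\<^sub>E {-1..1}"
      using x by (auto simp: unit_ball_d_def PiE_iff abs_le_iff minus_le_iff)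
  qed
  then have "emeasure (lborel_d d) (unit_ball_d d) \<le> ennreal (2 * 1) ^ d"
    by (subst box(1)[symmetric]) (auto intro!: emeasure_mono box)
  also have "ennreal (2 * 1) ^ d = ennreal ((2 * 1) ^ d)" by (rule ennreal_power) simp
  also have "\<dots> < \<infinity>" unfolding infinity_ennreal_def by (rule ennreal_less_top)
  finally show "emeasure (lborel_d d) (unit_ball_d d) \<noteq> \<infinity>" by simp
qed

lemma sets_uniform_sphere [simp, measurable_cong]: "sets (uniform_sphere d) = sets (lborel_d d)"
  by (simp add: uniform_sphere_def)

lemma prob_space_uniform_sphere:
  assumes "0 < d"
  shows "prob_space (uniform_sphere d)"
proof -
  interpret prob_space "uniform_measure (lborel_d d) (unit_ball_d d)"
    by (rule prob_space_uniform_measure) (use emeasure_unit_ball_d[OF assms] in auto)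
  show ?thesis unfolding uniform_sphere_def
    by (rule prob_space_distr) simp
qed

text \<open>Sign changes and transpositions of coordinates are enough to diagonalize the covariance
  of the uniform measure, so no rotation invariance is needed.\<close>

definition signed_perm :: "nat \<Rightarrow> (nat \<Rightarrow> real) \<Rightarrow> (nat \<Rightarrow> nat) \<Rightarrow> (nat \<Rightarrow> real) \<Rightarrow> nat \<Rightarrow> real" where
  "signed_perm d \<epsilon> \<pi> x = (\<lambda>i\<in>{..<d}. \<epsilon> i * x (\<pi> i))"

context
  fixes d :: nat and \<epsilon> :: "nat \<Rightarrow> real" and \<pi> :: "nat \<Rightarrow> nat"
  assumes \<epsilon>: "\<And>i. \<epsilon> i = 1 \<or> \<epsilon> i = -1" and \<pi>: "bij_betw \<pi> {..<d} {..<d}"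
begin

lemma signed_perm_measurable: "signed_perm d \<epsilon> \<pi> \<in> measurable (lborel_d d) (lborel_d d)"
proof -
  have "(\<lambda>x. \<lambda>i\<in>{..<d}. \<epsilon> i * x (\<pi> i)) \<in> measurable (lborel_d d) (lborel_d d)"
    using \<pi> by (intro measurable_into_d borel_measurable_times measurable_component_d)
       (auto simp: bij_betw_def)
  then show ?thesis by (simp add: signed_perm_def[abs_def])
qed

lemma L2_set_signed_perm: "L2_set (signed_perm d \<epsilon> \<pi> x) {..<d} = L2_set x {..<d}"
proof -
  have sq: "(\<epsilon> i * y)\<^sup>2 = y\<^sup>2" for i y using \<epsilon>[of i] by (auto simp: power_mult_distrib)
  have "(\<Sum>i<d. (signed_perm d \<epsilon> \<pi> x i)\<^sup>2) = (\<Sum>i<d. (x (\<pi> i))\<^sup>2)"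
    by (intro sum.cong) (auto simp: signed_perm_def sq)
  also have "\<dots> = (\<Sum>i<d. (x i)\<^sup>2)" by (rule sum.reindex_bij_betw[OF \<pi>])
  finally show ?thesis by (simp add: L2_set_def)
qed

text \<open>It suffices to compare measures of boxes. The preimage of a box is a box with permuted
  and reflected sides.\<close>

lemma distr_lborel_signed_perm: "distr (lborel_d d) (lborel_d d) (signed_perm d \<epsilon> \<pi>) = lborel_d d"
proof -
  have scale: "emeasure lborel ((\<lambda>y. \<epsilon> i * y) -` B) = emeasure lborel B" if "B \<in> sets borel" for i B
  proof (cases "\<epsilon> i = 1")
    case False
    then have "(\<lambda>y. \<epsilon> i * y) = uminus" using \<epsilon>[of i] by auto
    then have "emeasure lborel ((\<lambda>y. \<epsilon> i * y) -` B) = emeasure (distr lborel borel uminus) B"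
      using that by (subst emeasure_distr) auto
    then show ?thesis by (simp add: lborel_distr_uminus)
  qed simp
  \<comment> \<open>The inverse of \<open>\<pi>\<close> on the index set, describing which side ends
    up at which coordinate.\<close>
  obtain \<rho> where \<rho>: "bij_betw \<rho> {..<d} {..<d}" "\<And>i. i < d \<Longrightarrow> \<rho> (\<pi> i) = i" "\<And>i. i < d \<Longrightarrow> \<pi> (\<rho> i) = i"
    using \<pi> bij_betw_inv_into[OF \<pi>] bij_betw_inv_into_left[OF \<pi>] bij_betw_inv_into_right[OF \<pi>]
    by (metis lessThan_iff)
  have \<rho>d: "\<rho> i < d" "\<pi> i < d" if "i < d" for i
    using \<rho>(1) \<pi> that by (auto simp: bij_betw_def)
  have "distr (lborel_d d) (lborel_d d) (signed_perm d \<epsilon> \<pi>) = Pi\<^sub>M {..<d} (\<lambda>_. lborel)"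
  proof (rule lborel_product.PiM_eqI)
    fix A :: "nat \<Rightarrow> real set" assume A: "\<And>i. i \<in> {..<d} \<Longrightarrow> A i \<in> sets lborel"
    have pre: "signed_perm d \<epsilon> \<pi> -` (Pi\<^sub>E {..<d} A) \<inter> space (lborel_d d)
        = Pi\<^sub>E {..<d} (\<lambda>j. (\<lambda>y. \<epsilon> (\<rho> j) * y) -` A (\<rho> j))" (is "?L = ?R")
    proof (rule set_eqI)
      fix x
      have "x \<in> ?L \<longleftrightarrow> x \<in> extensional {..<d} \<and> (\<forall>i<d. \<epsilon> i * x (\<pi> i) \<in> A i)"
        by (auto simp: signed_perm_def space_lborel_d PiE_iff)
      also have "(\<forall>i<d. \<epsilon> i * x (\<pi> i) \<in> A i) \<longleftrightarrow> (\<forall>j<d. \<epsilon> (\<rho> j) * x j \<in> A (\<rho> j))"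
        using \<rho>(2,3) \<rho>d by metis
      also have "x \<in> extensional {..<d} \<and> \<dots> \<longleftrightarrow> x \<in> ?R"
        by (auto simp: PiE_iff)
      finally show "x \<in> ?L \<longleftrightarrow> x \<in> ?R" .
    qed
    have PA: "Pi\<^sub>E {..<d} A \<in> sets (lborel_d d)"
      using A unfolding lborel_d_def by (intro sets_PiM_I_finite) auto
    have vim: "(\<lambda>y. \<epsilon> (\<rho> j) * y) -` A (\<rho> j) \<in> sets lborel" if "j < d" for j
      using A[of "\<rho> j"] \<rho>d[OF that] measurable_sets[of "\<lambda>y. \<epsilon> (\<rho> j) * y" borel borel "A (\<rho> j)"] by auto
    have "emeasure (distr (lborel_d d) (lborel_d d) (signed_perm d \<epsilon> \<pi>)) (Pi\<^sub>E {..<d} A)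
       = emeasure (lborel_d d) (Pi\<^sub>E {..<d} (\<lambda>j. (\<lambda>y. \<epsilon> (\<rho> j) * y) -` A (\<rho> j)))"
      using PA by (simp add: emeasure_distr[OF signed_perm_measurable] pre)
    also have "\<dots> = (\<Prod>j<d. emeasure lborel ((\<lambda>y. \<epsilon> (\<rho> j) * y) -` A (\<rho> j)))"
      unfolding lborel_d_def using vim by (intro lborel_product.emeasure_PiM) auto
    also have "\<dots> = (\<Prod>j<d. emeasure lborel (A (\<rho> j)))"
      using A \<rho>d by (intro prod.cong scale) auto
    also have "\<dots> = (\<Prod>i<d. emeasure lborel (A i))" by (rule prod.reindex_bij_betw[OF \<rho>(1)])
    finally show "emeasure (distr (lborel_d d) (lborel_d d) (signed_perm d \<epsilon> \<pi>)) (Pi\<^sub>E {..<d} A)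
       = (\<Prod>i\<in>{..<d}. emeasure lborel (A i))" .
  qed (auto simp: lborel_d_def)
  then show ?thesis by (simp add: lborel_d_def)
qed

text \<open>Signed permutations preserve the norm, hence the ball, and commute with
  normalization.\<close>

lemma distr_uniform_sphere_signed_perm:
  assumes "0 < d"
  shows "distr (uniform_sphere d) (lborel_d d) (signed_perm d \<epsilon> \<pi>) = uniform_sphere d"
proof -
  let ?L = "lborel_d d" and ?B = "unit_ball_d d" and ?f = "signed_perm d \<epsilon> \<pi>"
  note [measurable] = signed_perm_measurable
  have "distr (uniform_measure ?L ?B) ?L ?f = uniform_measure ?L ?B"
  proof (rule measure_eqI)
    fix A assume "A \<in> sets (distr (uniform_measure ?L ?B) ?L ?f)"
    then have A [measurable]: "A \<in> sets ?L" by simp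
    have fsp: "?f x \<in> space ?L" if "x \<in> space ?L" for x
      using measurable_space[OF signed_perm_measurable that] .
    have "?B \<inter> (?f -` A \<inter> space ?L) = ?f -` (?B \<inter> A) \<inter> space ?L"
      using fsp by (auto simp: unit_ball_d_eq L2_set_signed_perm)
    then have "emeasure ?L (?B \<inter> (?f -` A \<inter> space ?L)) = emeasure (distr ?L ?L ?f) (?B \<inter> A)"
      by (simp add: emeasure_distr)
    then show "emeasure (distr (uniform_measure ?L ?B) ?L ?f) A = emeasure (uniform_measure ?L ?B) A"
      by (simp add: emeasure_distr distr_lborel_signed_perm)
  qed simp
  moreover have "?f (normalize_d d x) = normalize_d d (?f x)" if "x \<in> space ?L" for x
  proof
    fix i
    have "i < d \<Longrightarrow> \<pi> i < d" using \<pi> by (auto simp: bij_betw_def)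
    then show "?f (normalize_d d x) i = normalize_d d (?f x) i"
      unfolding normalize_d_def[of d "?f x"] L2_set_signed_perm
      by (auto simp: signed_perm_def normalize_d_def)
  qed
  then have "distr (uniform_sphere d) ?L ?f
      = distr (distr (uniform_measure ?L ?B) ?L ?f) ?L (normalize_d d)"
    unfolding uniform_sphere_def by (simp add: distr_distr cong: distr_cong)
       (intro distr_cong, auto)
  ultimately show ?thesis by (simp add: uniform_sphere_def)
qed

end

section \<open>Second moments of the uniform direction\<close>

lemma AE_uniform_sphere_norm: "AE x in uniform_sphere d. L2_set x {..<d} \<le> 1"
  unfolding uniform_sphere_def
proof (subst AE_distr_iff)
  \<comment> \<open>The inequality also covers the origin, where division by zero gives the zero
    vector.\<close>
  have "L2_set (normalize_d d x) {..<d} \<le> 1" for x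
  proof -
    have "L2_set (normalize_d d x) {..<d} = L2_set (\<lambda>i. (1 / L2_set x {..<d}) * x i) {..<d}"
      by (intro L2_set_cong) (auto simp: normalize_d_def)
    also have "\<dots> = (1 / L2_set x {..<d}) * L2_set x {..<d}"
      by (subst L2_set_right_distrib) (auto simp: L2_set_nonneg)
    finally show ?thesis by simp
  qed
  then show "AE x in uniform_measure (lborel_d d) (unit_ball_d d). L2_set (normalize_d d x) {..<d} \<le> 1"
    by simp
qed measurable

text \<open>Flipping the sign of coordinate \<open>i\<close> negates a mixed moment, and a
  transposition identifies any two diagonal ones. The \<open>d\<close> equal diagonal moments sum to
  at most 1 by the norm bound.\<close>

lemma second_moments:
  assumes d: "0 < d"
  shows integrable_coord_prod: "i < d \<Longrightarrow> j < d \<Longrightarrow> integrable (uniform_sphere d) (\<lambda>x. x i * x j)"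
    and off_diagonal: "i < d \<Longrightarrow> j < d \<Longrightarrow> i \<noteq> j \<Longrightarrow> (LINT x|uniform_sphere d. x i * x j) = 0"
    and diagonal: "i < d \<Longrightarrow> (LINT x|uniform_sphere d. (x i)\<^sup>2) \<le> 1 / real d"
proof -
  interpret prob_space "uniform_sphere d" by (rule prob_space_uniform_sphere[OF d])
  show int: "integrable (uniform_sphere d) (\<lambda>x. x i * x j)" if "i < d" "j < d" for i j
  proof (rule integrable_const_bound[where B = 1])
    show "AE x in uniform_sphere d. norm (x i * x j) \<le> 1"
      using AE_uniform_sphere_norm
    proof eventually_elim
      fix x assume "L2_set x {..<d} \<le> 1"
      then have "\<bar>x i\<bar> \<le> 1" "\<bar>x j\<bar> \<le> 1"
        using abs_le_L2_set[of "{..<d}" _ x] that by (force intro: order_trans)+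
      then show "norm (x i * x j) \<le> 1" by (simp add: abs_mult mult_le_one)
    qed
  qed (use that in measurable)
  have change: "(LINT x|uniform_sphere d. g (signed_perm d \<epsilon> \<pi> x)) = (LINT x|uniform_sphere d. g x)"
    if "\<And>i. \<epsilon> i = 1 \<or> \<epsilon> i = -1" "bij_betw \<pi> {..<d} {..<d}" "g \<in> borel_measurable (lborel_d d)"
    for g :: "(nat \<Rightarrow> real) \<Rightarrow> real" and \<epsilon> \<pi>
  proof -
    have "signed_perm d \<epsilon> \<pi> \<in> measurable (uniform_sphere d) (lborel_d d)"
      using signed_perm_measurable[of \<epsilon> \<pi> d] that(1,2) by simp
    from integral_distr[OF this that(3)] show ?thesis
      by (simp add: distr_uniform_sphere_signed_perm[OF that(1,2) d])
  qed
  show "(LINT x|uniform_sphere d. x i * x j) = 0" if "i < d" "j < d" "i \<noteq> j" for i j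
  proof -
    let ?\<epsilon> = "\<lambda>k. if k = i then -1 else 1 :: real"
    have "(LINT x|uniform_sphere d. x i * x j)
        = (LINT x|uniform_sphere d. signed_perm d ?\<epsilon> id x i * signed_perm d ?\<epsilon> id x j)"
      using that by (intro change[of _ _ "\<lambda>x. x i * x j", symmetric]
          borel_measurable_times measurable_component_d) auto
    also have "\<dots> = (LINT x|uniform_sphere d. - (x i * x j))"
      using that by (intro Bochner_Integration.integral_cong) (auto simp: signed_perm_def)
    finally show ?thesis by simp
  qed
  have same: "(LINT x|uniform_sphere d. (x i)\<^sup>2) = (LINT x|uniform_sphere d. (x j)\<^sup>2)"
    if "i < d" "j < d" for i j
  proof -
    let ?\<pi> = "\<lambda>k. if k = i then j else if k = j then i else k"
    have "bij_betw ?\<pi> {..<d} {..<d}"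
      by (rule bij_betw_byWitness[where f' = ?\<pi>]) (use that in auto)
    then have "(LINT x|uniform_sphere d. (x i)\<^sup>2)
        = (LINT x|uniform_sphere d. (signed_perm d (\<lambda>_. 1) ?\<pi> x i)\<^sup>2)"
      using that by (intro change[of _ _ "\<lambda>x. (x i)\<^sup>2", symmetric]
          borel_measurable_power measurable_component_d) auto
    also have "\<dots> = (LINT x|uniform_sphere d. (x j)\<^sup>2)"
      using that by (intro Bochner_Integration.integral_cong) (auto simp: signed_perm_def)
    finally show ?thesis .
  qed
  show "(LINT x|uniform_sphere d. (x i)\<^sup>2) \<le> 1 / real d" if "i < d"
  proof -
    have int2: "integrable (uniform_sphere d) (\<lambda>x. (x k)\<^sup>2)" if "k < d" for k
      using int[OF that that] by (simp add: power2_eq_square)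
    have "real d * (LINT x|uniform_sphere d. (x i)\<^sup>2) = (\<Sum>k<d. LINT x|uniform_sphere d. (x i)\<^sup>2)"
      by simp
    also have "\<dots> = (\<Sum>k<d. LINT x|uniform_sphere d. (x k)\<^sup>2)"
      using that by (intro sum.cong same) auto
    also have "\<dots> = (LINT x|uniform_sphere d. (\<Sum>k<d. (x k)\<^sup>2))"
      using int2 by (intro Bochner_Integration.integral_sum[symmetric]) auto
    also have "\<dots> \<le> (LINT x|uniform_sphere d. 1)"
    proof (rule integral_mono_AE)
      show "AE x in uniform_sphere d. (\<Sum>k<d. (x k)\<^sup>2) \<le> 1"
        using AE_uniform_sphere_norm by eventually_elim (simp add: L2_set_def)
    qed (use int2 in auto)
    also have "\<dots> = 1" by (simp add: prob_space)
    finally show ?thesis using d by (simp add: field_simps)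
  qed
qed

lemma unit_sphere_sum: "w \<in> unit_sphere d \<Longrightarrow> (\<Sum>i<d. (w i)\<^sup>2) = 1"
  by (auto simp: unit_sphere_def L2_set_def)

text \<open>The covariance is diagonal with entries at most \<open>1 / d\<close>, and
  \<open>w\<close> has norm 1.\<close>

lemma dot_second_moment:
  assumes d: "0 < d" and w: "w \<in> unit_sphere d"
  shows "integrable (uniform_sphere d) (\<lambda>x. (dot d x w)\<^sup>2)"
    and "(LINT x|uniform_sphere d. (dot d x w)\<^sup>2) \<le> 1 / real d"
proof -
  have sq: "(dot d x w)\<^sup>2 = (\<Sum>i<d. \<Sum>j<d. (w i * w j) * (x i * x j))" for x
    by (simp add: dot_def power2_eq_square sum_product mult_ac)
  have int: "integrable (uniform_sphere d) (\<lambda>x. (w i * w j) * (x i * x j))"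
    if "i < d" "j < d" for i j
    using integrable_coord_prod[OF d that] by simp
  show "integrable (uniform_sphere d) (\<lambda>x. (dot d x w)\<^sup>2)"
    unfolding sq using int by (intro Bochner_Integration.integrable_sum) auto
  have "(LINT x|uniform_sphere d. (dot d x w)\<^sup>2)
      = (\<Sum>i<d. \<Sum>j<d. (w i * w j) * (LINT x|uniform_sphere d. x i * x j))"
    unfolding sq using int
    by (subst Bochner_Integration.integral_sum) (auto intro!: sum.cong Bochner_Integration.integrable_sum
        simp: Bochner_Integration.integral_sum)
  also have "\<dots> = (\<Sum>i<d. \<Sum>j<d. if j = i then (w i)\<^sup>2 * (LINT x|uniform_sphere d. (x i)\<^sup>2) else 0)"
    using off_diagonal[OF d] by (intro sum.cong) (auto simp: power2_eq_square)
  also have "\<dots> = (\<Sum>i<d. (w i)\<^sup>2 * (LINT x|uniform_sphere d. (x i)\<^sup>2))"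
    by (intro sum.cong) auto
  also have "\<dots> \<le> (\<Sum>i<d. (w i)\<^sup>2 * (1 / real d))"
    by (intro sum_mono mult_left_mono diagonal[OF d]) auto
  also have "\<dots> = 1 / real d"
    unfolding sum_distrib_right[symmetric] unit_sphere_sum[OF w] by simp
  finally show "(LINT x|uniform_sphere d. (dot d x w)\<^sup>2) \<le> 1 / real d" .
qed

section \<open>Almost sure nonvanishing of the overlap\<close>

lemma null_hyperplane:
  assumes k: "k < d" and w: "w k \<noteq> 0"
  shows "AE x in lborel_d d. dot d x w \<noteq> 0"
proof -
  let ?H = "{x \<in> space (lborel_d d). dot d x w = 0}" and ?I = "{..<d} - {k}"
  have H: "?H \<in> sets (lborel_d d)" by measurable
  have ins: "insert k ?I = {..<d}" using k by auto
  have meas: "indicator ?H \<in> borel_measurable (Pi\<^sub>M (insert k ?I) (\<lambda>_. lborel))"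
    using H unfolding ins lborel_d_def[symmetric] by (rule borel_measurable_indicator)
  have "emeasure (lborel_d d) ?H = (\<integral>\<^sup>+x. indicator ?H x \<partial>Pi\<^sub>M (insert k ?I) (\<lambda>_. lborel))"
    using H unfolding ins by (simp add: lborel_d_def)
  also have "\<dots> = (\<integral>\<^sup>+x. \<integral>\<^sup>+y. indicator ?H (x(k := y)) \<partial>lborel \<partial>Pi\<^sub>M ?I (\<lambda>_. lborel))"
    using meas by (intro lborel_product.product_nn_integral_insert) auto
  also have "\<dots> = (\<integral>\<^sup>+x. 0 \<partial>Pi\<^sub>M ?I (\<lambda>_. lborel :: real measure))"
  proof (rule nn_integral_cong)
    fix x :: "nat \<Rightarrow> real"
    \<comment> \<open>With the other coordinates fixed, this is the only value of coordinate
      \<open>k\<close> on the hyperplane, so the inner integral in Fubini's theorem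
      vanishes.\<close>
    let ?y0 = "- (\<Sum>i\<in>?I. x i * w i) / w k"
    have "(\<integral>\<^sup>+y. indicator ?H (x(k := y)) \<partial>lborel) \<le> (\<integral>\<^sup>+y. indicator {?y0} y \<partial>lborel)"
    proof (rule nn_integral_mono)
      fix y :: real
      have "dot d (x(k := y)) w = y * w k + (\<Sum>i\<in>?I. x i * w i)"
        unfolding dot_def using k by (subst sum.remove[of _ k]) (auto intro!: sum.cong)
      then show "indicator ?H (x(k := y)) \<le> (indicator {?y0} y :: ennreal)"
        using w by (auto simp: indicator_def field_simps eq_neg_iff_add_eq_0)
    qed
    then show "(\<integral>\<^sup>+y. indicator ?H (x(k := y)) \<partial>lborel) = 0" by simp
  qed
  finally have "emeasure (lborel_d d) ?H = 0" by simp
  then show ?thesis using H by (intro AE_I[of _ _ ?H]) auto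
qed

text \<open>Normalization divides the inner product by the norm, which is nonzero wherever the inner
  product is.\<close>

lemma AE_uniform_sphere_dot:
  assumes w: "w \<in> unit_sphere d"
  shows "AE x in uniform_sphere d. dot d x w \<noteq> 0"
proof -
  obtain k where k: "k < d" "w k \<noteq> 0"
    using unit_sphere_sum[OF w] by (metis (no_types, lifting) lessThan_iff power2_eq_square
      mult_zero_left sum.neutral zero_neq_one)
  have "AE x in lborel_d d. x \<in> unit_ball_d d \<longrightarrow> dot d (normalize_d d x) w \<noteq> 0"
    using null_hyperplane[of k d w, OF k]
  proof eventually_elim
    fix x assume x: "dot d x w \<noteq> 0"
    have "dot d (normalize_d d x) w = dot d x w / L2_set x {..<d}"
      unfolding dot_def sum_divide_distrib by (intro sum.cong) (auto simp: normalize_d_def)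
    moreover have "L2_set x {..<d} \<noteq> 0"
    proof
      assume "L2_set x {..<d} = 0"
      then have "x i = 0" if "i < d" for i using abs_le_L2_set[of "{..<d}" i x] that by simp
      then show False using x by (simp add: dot_def)
    qed
    ultimately show "x \<in> unit_ball_d d \<longrightarrow> dot d (normalize_d d x) w \<noteq> 0" using x by simp
  qed
  then have "AE x in uniform_measure (lborel_d d) (unit_ball_d d). dot d (normalize_d d x) w \<noteq> 0"
    by (intro AE_uniform_measureI) simp
  moreover have "{x \<in> space (lborel_d d). dot d x w \<noteq> 0} \<in> sets (lborel_d d)" by measurable
  moreover have "normalize_d d \<in> measurable (uniform_measure (lborel_d d) (unit_ball_d d)) (lborel_d d)"
    using normalize_d_measurable[of d] by simp
  ultimately show ?thesis
    unfolding uniform_sphere_def by (simp add: AE_distr_iff)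
qed

section \<open>The event of good initializations\<close>

definition good_directions :: "nat \<Rightarrow> real \<Rightarrow> (nat \<Rightarrow> real) \<Rightarrow> (nat \<Rightarrow> real) set" where
  "good_directions d R w =
    {x \<in> space (uniform_sphere d). dot d x w \<noteq> 0 \<and> (dot d x w)\<^sup>2 \<le> R / real d}"

lemma good_directions_sets: "good_directions d R w \<in> sets (uniform_sphere d)"
  unfolding good_directions_def by measurable

text \<open>Markov's inequality for the squared overlap; the factor \<open>1 / d\<close> cancels, so
  the probability does not depend on the dimension.\<close>

lemma measure_good_directions:
  assumes d: "0 < d" and w: "w \<in> unit_sphere d" and R: "0 < R"
  shows "measure (uniform_sphere d) (good_directions d R w) \<ge> 1 - 1 / R"
proof -
  interpret prob_space "uniform_sphere d" by (rule prob_space_uniform_sphere[OF d])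
  let ?B = "{x \<in> space (uniform_sphere d). R / real d \<le> (dot d x w)\<^sup>2}"
  have "measure (uniform_sphere d) ?B \<le> (LINT x|uniform_sphere d. (dot d x w)\<^sup>2) / (R / real d)"
    using dot_second_moment(1)[OF d w] d R
    by (intro integral_Markov_inequality_measure[where A = "{}"]) auto
  also have "\<dots> \<le> (1 / real d) / (R / real d)"
    using dot_second_moment(2)[OF d w] d R by (intro divide_right_mono) auto
  also have "\<dots> = 1 / R" using d by simp
  finally have B: "measure (uniform_sphere d) ?B \<le> 1 / R" .
  have Bs: "?B \<in> events" by measurable
  have "1 - measure (uniform_sphere d) ?B = measure (uniform_sphere d) (space (uniform_sphere d) - ?B)"
    using prob_compl[OF Bs] by simp
  also have "\<dots> \<le> measure (uniform_sphere d) (good_directions d R w)"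
  proof (rule finite_measure_mono_AE)
    show "AE x in uniform_sphere d. x \<in> space (uniform_sphere d) - ?B \<longrightarrow> x \<in> good_directions d R w"
      using AE_uniform_sphere_dot[OF w] by eventually_elim (auto simp: good_directions_def)
  qed (rule good_directions_sets)
  finally show ?thesis using B by linarith
qed

definition coefficient_law :: "(nat \<Rightarrow> real) measure" where
  "coefficient_law = (\<Pi>\<^sub>M k\<in>{1::nat..}. uniform_measure lborel {-1..1::real})"

text \<open>The lower bound on \<open>\<bar>u 1\<bar>\<close> keeps the initial velocity away from
  zero when \<open>s = 1\<close>; the upper bounds feed \<open>flow\<close>.\<close>

definition good_coefficients :: "real \<Rightarrow> (nat \<Rightarrow> real) set" where
  "good_coefficients e = {u \<in> space coefficient_law. (\<forall>k\<ge>1. \<bar>u k\<bar> \<le> 1) \<and> e \<le> \<bar>u 1\<bar>}"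

lemma prob_space_uniform_interval: "prob_space (uniform_measure lborel {-1..1::real})"
  by (rule prob_space_uniform_measure) auto

lemma prob_space_coefficient_law: "prob_space coefficient_law"
  unfolding coefficient_law_def by (intro prob_space_PiM prob_space_uniform_interval)

lemma measurable_coefficient:
  assumes "1 \<le> k"
  shows "(\<lambda>u. u k) \<in> borel_measurable coefficient_law"
proof -
  have "sets (uniform_measure lborel {-1..1::real}) = sets borel" by simp
  from measurable_cong_sets[OF refl this] show ?thesis
    unfolding coefficient_law_def
    using measurable_component_singleton[of k "{1..}" "\<lambda>_. uniform_measure lborel {-1..1::real}"] assms
    by blast
qed

lemma good_coefficients_sets: "good_coefficients e \<in> sets coefficient_law"
proof -
  have "{u \<in> space coefficient_law. \<forall>k. 1 \<le> k \<longrightarrow> \<bar>u k\<bar> \<le> 1} \<in> sets coefficient_law"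
  proof (rule sets.sets_Collect_countable_All)
    fix k :: nat
    show "{u \<in> space coefficient_law. 1 \<le> k \<longrightarrow> \<bar>u k\<bar> \<le> 1} \<in> sets coefficient_law"
    proof (cases "1 \<le> k")
      case True
      note [measurable] = measurable_coefficient[OF True]
      have "{u \<in> space coefficient_law. \<bar>u k\<bar> \<le> 1} \<in> sets coefficient_law" by measurable
      then show ?thesis using True by simp
    qed auto
  qed
  moreover have "{u \<in> space coefficient_law. e \<le> \<bar>u 1\<bar>} \<in> sets coefficient_law"
    using measurable_coefficient[of 1] by measurable
  ultimately have "{u \<in> space coefficient_law. \<forall>k. 1 \<le> k \<longrightarrow> \<bar>u k\<bar> \<le> 1}
      \<inter> {u \<in> space coefficient_law. e \<le> \<bar>u 1\<bar>} \<in> sets coefficient_law" by (rule sets.Int)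
  moreover have "good_coefficients e = {u \<in> space coefficient_law. \<forall>k. 1 \<le> k \<longrightarrow> \<bar>u k\<bar> \<le> 1}
      \<inter> {u \<in> space coefficient_law. e \<le> \<bar>u 1\<bar>}"
    by (auto simp: good_coefficients_def)
  ultimately show ?thesis by (rule ssubst[rotated])
qed

lemma measure_good_coefficients:
  assumes e: "0 \<le> e" "e \<le> 1"
  shows "measure coefficient_law (good_coefficients e) \<ge> 1 - e"
proof -
  let ?U = "uniform_measure lborel {-1..1::real}"
  interpret prob_space coefficient_law by (rule prob_space_coefficient_law)
  have "AE u in coefficient_law. 1 \<le> k \<longrightarrow> \<bar>u k\<bar> \<le> 1" for k :: nat
  proof (cases "1 \<le> k")
    case True
    have "AE x in ?U. \<bar>x\<bar> \<le> 1" by (intro AE_uniform_measureI) auto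
    then have "AE u in coefficient_law. \<bar>u k\<bar> \<le> 1"
      unfolding coefficient_law_def using True prob_space_uniform_interval
      by (intro AE_PiM_component[where P = "\<lambda>x. \<bar>x\<bar> \<le> 1"]) auto
    then show ?thesis by simp
  qed simp
  then have AE: "AE u in coefficient_law. \<forall>k\<ge>1. \<bar>u k\<bar> \<le> 1"
    by (simp add: AE_all_countable)
  let ?B = "{u \<in> space coefficient_law. \<bar>u 1\<bar> < e}"
  have Bs: "?B \<in> events" using measurable_coefficient[of 1] by measurable
  have "measure coefficient_law ?B = measure (distr coefficient_law ?U (\<lambda>u. u 1)) {-e<..<e}"
    using measurable_coefficient[of 1]
    by (subst measure_distr) (auto intro!: arg_cong[where f = "measure _"] simp: abs_less_iff)
  also have "distr coefficient_law ?U (\<lambda>u. u 1) = ?U"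
    unfolding coefficient_law_def
    by (rule distr_PiM_component) (auto intro: prob_space_uniform_interval)
  also have "measure ?U {-e<..<e} = measure lborel ({-1..1} \<inter> {-e<..<e}) / measure lborel {-1..1::real}"
    by (subst measure_uniform_measure) auto
  also have "{-1..1} \<inter> {-e<..<e} = {-e<..<e}" using e by auto
  also have "measure lborel {-e<..<e} / measure lborel {-1..1::real} = e" using e by simp
  finally have B: "measure coefficient_law ?B = e" .
  have "1 - e = measure coefficient_law (space coefficient_law - ?B)"
    using prob_compl[OF Bs] B by simp
  also have "\<dots> \<le> measure coefficient_law (good_coefficients e)"
  proof (rule finite_measure_mono_AE)
    show "AE u in coefficient_law. u \<in> space coefficient_law - ?B \<longrightarrow> u \<in> good_coefficients e"
      using AE by eventually_elim (auto simp: good_coefficients_def)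
  qed (rule good_coefficients_sets)
  finally show ?thesis .
qed

text \<open>Independence makes the probability a product, and
  \<open>(1 - x) * (1 - y) \<ge> 1 - (x + y)\<close> for nonnegative \<open>x\<close> and
  \<open>y\<close>.\<close>

lemma measure_good_init:
  assumes d: "0 < d" and w: "w \<in> unit_sphere d" and R: "1 \<le> R" and e: "0 \<le> e" "e \<le> 1"
  shows "good_directions d R w \<times> good_coefficients e \<in> sets (init_law d)"
    and "measure (init_law d) (good_directions d R w \<times> good_coefficients e) \<ge> 1 - (1 / R + e)"
proof -
  interpret S: prob_space "uniform_sphere d" by (rule prob_space_uniform_sphere[OF d])
  interpret C: prob_space coefficient_law by (rule prob_space_coefficient_law)
  have law: "init_law d = uniform_sphere d \<Otimes>\<^sub>M coefficient_law"
    by (simp add: init_law_def coefficient_law_def)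
  show "good_directions d R w \<times> good_coefficients e \<in> sets (init_law d)"
    unfolding law by (intro pair_measureI good_directions_sets good_coefficients_sets)
  have "measure (init_law d) (good_directions d R w \<times> good_coefficients e)
    = measure (uniform_sphere d) (good_directions d R w) * measure coefficient_law (good_coefficients e)"
    unfolding law measure_def
    by (subst C.emeasure_pair_measure_Times[OF good_directions_sets good_coefficients_sets])
       (rule enn2real_mult)
  also have "\<dots> \<ge> (1 - 1 / R) * (1 - e)"
    using measure_good_directions[OF d w, of R] measure_good_coefficients[OF e] R e
    by (intro mult_mono) auto
  also have "(1 - 1 / R) * (1 - e) = 1 - (1 / R + e) + e / R"
    by (simp add: algebra_simps diff_divide_distrib)
  also have "\<dots> \<ge> 1 - (1 / R + e)" using R e by simp
  finally show "measure (init_law d) (good_directions d R w \<times> good_coefficients e) \<ge> 1 - (1 / R + e)" .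
qed

section \<open>The main theorem\<close>

lemma information_exponent_eqD:
  assumes "information_exponent \<phi> = enat s"
  shows "1 \<le> s" "hermite_coeff \<phi> s \<noteq> 0" "\<And>k. 1 \<le> k \<Longrightarrow> k < s \<Longrightarrow> hermite_coeff \<phi> k = 0"
proof -
  let ?K = "{k. 1 \<le> k \<and> hermite_coeff \<phi> k \<noteq> 0}"
  have Inf: "Inf (enat ` ?K) = enat s" using assms by (simp add: information_exponent_def)
  \<comment> \<open>The infimum of the empty set is infinite, whereas a nonempty set of extended
    naturals attains its infimum.\<close>
  have ne: "enat ` ?K \<noteq> {}"
  proof
    assume "enat ` ?K = {}"
    then show False using Inf by (simp only: Inf_enat_def) simp
  qed
  then have "Inf (enat ` ?K) \<in> enat ` ?K"
    using ne by (metis Inf_enat_def LeastI ex_in_conv)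
  then have "enat s \<in> enat ` ?K" unfolding Inf .
  then show "1 \<le> s" "hermite_coeff \<phi> s \<noteq> 0" by auto
  show "hermite_coeff \<phi> k = 0" if "1 \<le> k" "k < s" for k
  proof (rule ccontr)
    assume "hermite_coeff \<phi> k \<noteq> 0"
    then have "Inf (enat ` ?K) \<le> enat k" using that by (intro Inf_lower) auto
    then show False using that unfolding Inf by simp
  qed
qed

lemma (in sobolev_coeffs) flow_of_good_init:
  assumes "(w0, u) \<in> good_directions d R w \<times> good_coefficients e" "a00 \<in> {-1..1}"
    and "flow_solution A m a" "initial_condition d w w0 u a00 m a"
  shows "flow A m a" "m 0 \<noteq> 0" "(m 0)\<^sup>2 \<le> R / real d" "e \<le> \<bar>a 1 0\<bar>"
proof -
  have a: "(real k)\<^sup>2 * a k 0 = u k" "\<bar>u k\<bar> \<le> 1" if "1 \<le> k" for k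
    using assms that by (auto simp: initial_condition_def good_coefficients_def)
  show "flow A m a"
  proof
    fix k :: nat assume k: "1 \<le> k"
    have "(real k)\<^sup>2 * \<bar>a k 0\<bar> = \<bar>u k\<bar>" unfolding a(1)[OF k, symmetric] by (simp add: abs_mult)
    then show "(real k)\<^sup>2 * \<bar>a k 0\<bar> \<le> 1" using a(2)[OF k] by simp
  qed (use assms in \<open>auto simp: initial_condition_def\<close>)
  show "m 0 \<noteq> 0" "(m 0)\<^sup>2 \<le> R / real d" "e \<le> \<bar>a 1 0\<bar>"
    using assms a(1)[of 1]
    by (auto simp: initial_condition_def good_directions_def good_coefficients_def)
qed

text \<open>Turns a deterministic conclusion on the good event into the probabilistic statement, for
  both cases at once. The sequence \<open>b\<close> is the normalized profile and does not depend on
  the initialization.\<close>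

lemma (in sobolev_coeffs) with_high_probability:
  assumes \<eta>: "0 < \<eta>" "\<eta> < 1" and \<kappa>: "\<kappa> \<in> {0<..<1::real}" and c: "0 < c" and C: "0 < C" and C': "0 < C'"
    and conv: "\<And>d m a. d0 \<le> d \<Longrightarrow> flow A m a \<Longrightarrow> m 0 \<noteq> 0 \<Longrightarrow> (m 0)\<^sup>2 \<le> 4 / \<eta> / real d \<Longrightarrow>
      \<eta> / 2 \<le> \<bar>a 1 0\<bar> \<Longrightarrow>
      (s \<ge> 2 \<longrightarrow> escapes_and_converges A s \<kappa> c C C' d (\<lambda>k. profile A k / profile_norm) m a) \<and>
      (s = 1 \<longrightarrow> converges_from_start A c C (\<lambda>k. profile A k / profile_norm) m a)"
  shows "\<exists>\<kappa>\<in>{0<..<1::real}. \<exists>c>0::real. \<exists>C>0::real. \<exists>C'>0::real. \<exists>d0::nat.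
    \<forall>d\<ge>d0. \<forall>w\<in>unit_sphere d. \<exists>G\<in>sets (init_law d). measure (init_law d) G \<ge> 1 - \<eta> \<and>
     (\<forall>(w0, u)\<in>G. \<forall>a00\<in>{-1..1}. \<exists>b. (\<forall>k. b k \<ge> 0) \<and> (\<lambda>k. (b k)\<^sup>2) sums 1 \<and>
       (\<forall>m a. flow_solution A m a \<and> initial_condition d w w0 u a00 m a \<longrightarrow>
         (s \<ge> 2 \<longrightarrow> escapes_and_converges A s \<kappa> c C C' d b m a) \<and>
         (s = 1 \<longrightarrow> converges_from_start A c C b m a)))"
proof (rule bexI[OF _ \<kappa>], rule exI[of _ c], rule conjI[OF c], rule exI[of _ C], rule conjI[OF C],
    rule exI[of _ C'], rule conjI[OF C'], rule exI[of _ "max 1 d0"], intro allI impI ballI)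
  fix d w assume d: "max 1 d0 \<le> d" and w: "w \<in> unit_sphere d"
  \<comment> \<open>The failure probability is at most \<open>\<eta> / 4\<close> from the direction
    plus \<open>\<eta> / 2\<close> from the first coefficient.\<close>
  let ?G = "good_directions d (4 / \<eta>) w \<times> good_coefficients (\<eta> / 2)"
  let ?b = "\<lambda>k. profile A k / profile_norm"
  have init: "?G \<in> sets (init_law d)" "1 - (1 / (4 / \<eta>) + \<eta> / 2) \<le> measure (init_law d) ?G"
    using measure_good_init[of d w "4 / \<eta>" "\<eta> / 2"] \<eta> d w by auto
  show "\<exists>G\<in>sets (init_law d). measure (init_law d) G \<ge> 1 - \<eta> \<and>
     (\<forall>(w0, u)\<in>G. \<forall>a00\<in>{-1..1}. \<exists>b. (\<forall>k. b k \<ge> 0) \<and> (\<lambda>k. (b k)\<^sup>2) sums 1 \<and>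
       (\<forall>m a. flow_solution A m a \<and> initial_condition d w w0 u a00 m a \<longrightarrow>
         (s \<ge> 2 \<longrightarrow> escapes_and_converges A s \<kappa> c C C' d b m a) \<and>
         (s = 1 \<longrightarrow> converges_from_start A c C b m a)))"
  proof (rule bexI[OF _ init(1)], rule conjI)
    have "1 / (4 / \<eta>) + \<eta> / 2 \<le> \<eta>" using \<eta> by simp
    then show "1 - \<eta> \<le> measure (init_law d) ?G" using init(2) by linarith
    have "\<exists>b. (\<forall>k. b k \<ge> 0) \<and> (\<lambda>k. (b k)\<^sup>2) sums 1 \<and>
       (\<forall>m a. flow_solution A m a \<and> initial_condition d w w0 u a00 m a \<longrightarrow>
         (s \<ge> 2 \<longrightarrow> escapes_and_converges A s \<kappa> c C C' d b m a) \<and>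
         (s = 1 \<longrightarrow> converges_from_start A c C b m a))"
      if "(w0, u) \<in> ?G" "a00 \<in> {-1..1}" for w0 u a00
    proof (rule exI[of _ ?b], intro conjI[OF _ conjI[OF normalized_profile_sums]] allI impI)
      show "0 \<le> ?b k" for k using profile_pos profile_norm_ge1 by simp
      fix m a assume "flow_solution A m a \<and> initial_condition d w w0 u a00 m a"
      then show "(s \<ge> 2 \<longrightarrow> escapes_and_converges A s \<kappa> c C C' d ?b m a) \<and>
          (s = 1 \<longrightarrow> converges_from_start A c C ?b m a)"
        using d flow_of_good_init[OF that] by (intro conv) auto
    qed
    then show "\<forall>(w0, u)\<in>?G. \<forall>a00\<in>{-1..1}. \<exists>b. (\<forall>k. b k \<ge> 0) \<and> (\<lambda>k. (b k)\<^sup>2) sums 1 \<and>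
       (\<forall>m a. flow_solution A m a \<and> initial_condition d w w0 u a00 m a \<longrightarrow>
         (s \<ge> 2 \<longrightarrow> escapes_and_converges A s \<kappa> c C C' d b m a) \<and>
         (s = 1 \<longrightarrow> converges_from_start A c C b m a))"
      by blast
  qed
qed

theorem theorem1:
  fixes \<phi> :: "real \<Rightarrow> real" and s :: nat
  assumes "\<phi> \<in> borel_measurable borel"
    and "integrable std_normal_distribution (\<lambda>x. (\<phi> x)\<^sup>2)"
    and "summable (\<lambda>k. (real k)\<^sup>2 * \<bar>hermite_coeff \<phi> k\<bar>\<^sup>2)"
    and "information_exponent \<phi> = enat s"
  shows "\<forall>\<eta>\<in>{0<..<1::real}. \<exists>\<kappa>\<in>{0<..<1::real}. \<exists>c>0::real. \<exists>C>0::real. \<exists>C'>0::real. \<exists>d0::nat.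
    \<forall>d\<ge>d0. \<forall>wstar\<in>unit_sphere d. \<exists>G\<in>sets (init_law d). measure (init_law d) G \<ge> 1 - \<eta> \<and>
     (\<forall>(w0, u)\<in>G. \<forall>a00\<in>{-1..1}. \<exists>b. (\<forall>k. b k \<ge> 0) \<and> (\<lambda>k. (b k)\<^sup>2) sums 1 \<and>
       (\<forall>m a. flow_solution (hermite_coeff \<phi>) m a \<and> initial_condition d wstar w0 u a00 m a \<longrightarrow>
         (s \<ge> 2 \<longrightarrow>
           (\<exists>\<tau>. hitting_time \<kappa> m = ereal \<tau> \<and> \<tau> \<ge> C' * real d ^ (s - 1) \<and>
             (\<forall>t\<ge>\<tau>.
               (m 0 > 0 \<longrightarrow> \<bar>1 - m t\<bar> \<le> C * exp (- c * (t - \<tau>)) \<and>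
                  (\<forall>k. \<bar>a k t - hermite_coeff \<phi> k\<bar> \<le> C * b k * exp (- c * (t - \<tau>)))) \<and>
               (m 0 < 0 \<longrightarrow> \<bar>1 + m t\<bar> \<le> C * exp (- c * (t - \<tau>)) \<and>
                  (\<forall>k. \<bar>a k t - (-1) ^ k * hermite_coeff \<phi> k\<bar> \<le> C * b k * exp (- c * (t - \<tau>))))))) \<and>
         (s = 1 \<longrightarrow>
           (\<forall>t\<ge>0.
             (hermite_coeff \<phi> 1 * a 1 0 > 0 \<longrightarrow> \<bar>1 - m t\<bar> \<le> C * exp (- c * t) \<and>
                (\<forall>k. \<bar>a k t - hermite_coeff \<phi> k\<bar> \<le> C * b k * exp (- c * t))) \<and>
             (hermite_coeff \<phi> 1 * a 1 0 < 0 \<longrightarrow> \<bar>1 + m t\<bar> \<le> C * exp (- c * t) \<and>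
                (\<forall>k. \<bar>a k t - (-1) ^ k * hermite_coeff \<phi> k\<bar> \<le> C * b k * exp (- c * t)))))))"
proof -
  define A where "A = hermite_coeff \<phi>"
  interpret sobolev_coeffs A
    using assms(3) by unfold_locales (simp add: A_def)
  have s: "1 \<le> s" "A s \<noteq> 0" and A_low: "\<And>k. 1 \<le> k \<Longrightarrow> k < s \<Longrightarrow> A k = 0"
    using information_exponent_eqD[OF assms(4)] unfolding A_def by blast+
  show ?thesis
    unfolding A_def[symmetric] escapes_and_converges_def[symmetric] converges_from_start_def[symmetric]
  proof (intro ballI, goal_cases)
    case (1 \<eta>)
    then have \<eta>: "0 < \<eta>" "\<eta> < 1" by auto
    show ?case
    proof (cases "s = 1")
      case False
      then have s2: "2 \<le> s" using s(1) by simp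
      have R: "0 < 4 / \<eta>" using \<eta> by simp
      obtain c C C' and d0 :: nat where pos: "0 < c" "0 < C" "0 < C'"
        and conv: "\<And>d m a. d0 \<le> d \<Longrightarrow> flow A m a \<and> m 0 \<noteq> 0 \<and> (m 0)\<^sup>2 \<le> 4 / \<eta> / real d \<Longrightarrow>
          escapes_and_converges A s (1 / 2) c C C' d (\<lambda>k. profile A k / profile_norm) m a"
        using convergence_superlinear[OF s2 A_low s(2) R] by blast
      show ?thesis
        by (rule with_high_probability[OF \<eta> _ pos, of "1 / 2" d0]) (use conv False in auto)
    next
      case True
      have "0 < \<bar>A 1\<bar> * (\<eta> / 2)" using s(2) True \<eta> by simp
      from convergence_linear[OF this] obtain c C \<delta> where pos: "0 < c" "0 < C" and \<delta>: "0 < \<delta>"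
        and conv: "\<And>m a. flow A m a \<and> \<bar>m 0\<bar> < \<delta> \<and> \<bar>A 1\<bar> * (\<eta> / 2) \<le> \<bar>A 1 * a 1 0\<bar> \<Longrightarrow>
          converges_from_start A c C (\<lambda>k. profile A k / profile_norm) m a"
        by auto
      \<comment> \<open>Makes \<open>4 / \<eta> / d < \<delta>\<^sup>2\<close>, so the good event
        forces \<open>\<bar>m 0\<bar> < \<delta>\<close>.\<close>
      define d0 where "d0 = nat \<lceil>4 / \<eta> / \<delta>\<^sup>2\<rceil> + 1"
      have small: "\<bar>x\<bar> < \<delta>" if "d0 \<le> d" "x\<^sup>2 \<le> 4 / \<eta> / real d" for d and x :: real
      proof -
        have "4 / \<eta> / \<delta>\<^sup>2 \<le> real (nat \<lceil>4 / \<eta> / \<delta>\<^sup>2\<rceil>)" by (rule real_nat_ceiling_ge)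
        then have d: "4 / \<eta> / \<delta>\<^sup>2 < real d" using that(1) unfolding d0_def by linarith
        have "0 < 4 / \<eta> / \<delta>\<^sup>2" using \<eta> \<delta> by simp
        then have "0 < real d" using d by linarith
        then have "4 / \<eta> / real d < \<delta>\<^sup>2" using d \<delta> \<eta> by (simp add: field_simps)
        then have "\<bar>x\<bar>\<^sup>2 < \<delta>\<^sup>2" using that(2) by simp
        then show ?thesis by (rule power2_less_imp_less) (use \<delta> in simp)
      qed
      have "converges_from_start A c C (\<lambda>k. profile A k / profile_norm) m a"
        if "d0 \<le> d" "flow A m a" "(m 0)\<^sup>2 \<le> 4 / \<eta> / real d" "\<eta> / 2 \<le> \<bar>a 1 0\<bar>" for d m a
      proof (intro conv conjI)
        show "\<bar>A 1\<bar> * (\<eta> / 2) \<le> \<bar>A 1 * a 1 0\<bar>"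
          unfolding abs_mult using that(4) by (intro mult_left_mono) auto
      qed (use that small in blast)+
      then show ?thesis
        \<comment> \<open>The values \<open>1 / 2\<close> for \<open>\<kappa>\<close> and 1 for
          \<open>C'\<close> are arbitrary: they constrain only the case
          \<open>s \<ge> 2\<close>.\<close>
        by (intro with_high_probability[OF \<eta> _ pos, of "1 / 2" 1 d0]) (use True in auto)
    qed
  qed
qed

end
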